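(* Let $A=R/J$ be an Artinian Gorenstein $k$-algebra and let $I$ be an ideal in $A$ with end degree $u$, i.e. $I^u\neq 0$ and $I^{u+1}=0$. For $0\le a\le u$ let $H(a)$ denote the Hilbert function of $Q(a)$. Then the Hilbert function of the associated graded ring $G(I)$ satisfies $$\mathrm{HF}(G(I))_i=\sum_{a=0}^{u}H(a)_i\qquad\text{for all } i,$$ and each $H(a)$ is symmetric about $(u-a)/2$, that is, $H(a)_v=H(a)_{u-a-v}$ for all integers $v$.
   Context: Setting: $k$ is a field, $(R,\mathcal M)$ is a local ring over $k$ (a local $k$-algebra) with $k=R/\mathcal M$, and $J$ is an ideal of $R$ such that $A=R/J$ is an Artinian Gorenstein local ring ("AG $k$-algebra"); $\mathfrak m=\mathcal M/J$. For an ideal $I$ of $A$, the end degree of $I$ is the integer $u\ge 0$ with $I^u\ne 0$ and $I^{u+1}=0$. The associated graded ring is $G(I)=\bigoplus_{n\ge 0}I^n/I^{n+1}$, where $I^0=A$. The Hilbert function of a graded module $S=\bigoplus_i S_i$ over $G(I)$ is $\mathrm{HF}(S)_i=\ell(S_i)$ (length over $G(I)_0=A/I$, equivalently $\dim_k S_i$); it is $0$ for $i<0$. For an ideal $L$ of $A$, $(0:L)=\{x\in A: xL=0\}$, and $I^n=A$ for $n\le 0$. For $a\geq 0$, $C(a)$ is the graded ideal of $G(I)$ whose component in degree $i\ge 0$ is $$C(a)_i=\frac{(0:I^{u+1-a-i})\cap I^i}{(0:I^{u+1-a-i})\cap I^{i+1}}\cong\frac{(0:I^{u+1-a-i})\cap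 I^i+I^{i+1}}{I^{i+1}}\subseteq I^i/I^{i+1}.$$ These form a decreasing sequence $G(I)=C(0)\supseteq C(1)\supseteq\cdots\supseteq C(u+1)=0$. Set $Q(a)=C(a)/C(a+1)$, a graded $G(I)$-module. *)

theory Defs
  imports
    "HOL-Algebra.Module"
    "HOL-Algebra.QuotRing"
    "HOL-Algebra.Ideal_Product"
    "HOL-Library.Extended_Nat"
begin

section \<open>Length and quotients of modules\<close>

text \<open>The length is the supremum of the lengths \<open>n\<close> of strict chains
  \<open>N 0 \<subset> N 1 \<subset> \<dots> \<subset> N n\<close> of submodules; it is \<open>\<infinity>\<close> for modules of infinite length.\<close>

definition module_length :: "('a, 'c) ring_scheme \<Rightarrow> ('a, 'b, 'd) module_scheme \<Rightarrow> enat"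
  where "module_length R M =
    (SUP n \<in> {n. \<exists>N :: nat \<Rightarrow> 'b set.
        (\<forall>i\<le>n. submodule (N i) R M) \<and> (\<forall>i<n. N i \<subset> N (Suc i))}. enat n)"

text \<open>The record type \<^typ>\<open>('a, 'b) module\<close> extends that of rings, so it carries
  the fields \<open>mult\<close> and \<open>one\<close>, which play no role for a module.\<close>

definition FactModule :: "('a, 'b, 'd) module_scheme \<Rightarrow> 'b set \<Rightarrow> ('a, 'b set) module"
  where "FactModule M N =
    \<lparr>carrier = a_rcosets\<^bsub>M\<^esub> N, mult = undefined, one = undefined,
     zero = N, add = set_add M,
     smult = (\<lambda>c X. \<Union>x\<in>X. N +>\<^bsub>M\<^esub> (c \<odot>\<^bsub>M\<^esub> x))\<rparr>"

definition ideal_module :: "('a, 'b) ring_scheme \<Rightarrow> 'a set \<Rightarrow> ('a, 'a) module"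
  where "ideal_module A L =
    \<lparr>carrier = L, mult = undefined, one = undefined,
     zero = \<zero>\<^bsub>A\<^esub>, add = add A, smult = mult A\<rparr>"


section \<open>Artinian Gorenstein local rings\<close>

text \<open>The annihilator \<open>(0 : L)\<close>.\<close>

definition annihilator :: "('a, 'b) ring_scheme \<Rightarrow> 'a set \<Rightarrow> 'a set"
  where "annihilator A L = {x \<in> carrier A. \<forall>y\<in>L. x \<otimes>\<^bsub>A\<^esub> y = \<zero>\<^bsub>A\<^esub>}"

locale local_ring = maximalideal M R + cring R for M and R (structure) +
  assumes maximal_unique: "maximalideal N R \<Longrightarrow> N = M"

locale artinian_ring = ring R for R (structure) +
  assumes descending_chain: "\<lbrakk>\<And>n :: nat. ideal (L n) R; \<And>n. L (Suc n) \<subseteq> L n\<rbrakk>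
    \<Longrightarrow> \<exists>n. \<forall>m\<ge>n. L m = L n"

text \<open>An Artinian local ring is Gorenstein if its socle \<open>(0 : M)\<close> has dimension one over the
  residue field \<open>R/M\<close>. As \<open>M\<close> kills the socle, this dimension is the length of
  the socle as an \<open>R\<close>-module.\<close>

locale artinian_gorenstein_ring = local_ring M R + artinian_ring R for M and R (structure) +
  assumes socle_length: "module_length R (ideal_module R (annihilator R M)) = 1"


section \<open>The associated graded ring and its filtration\<close>

abbreviation ideal_power :: "('a, 'b) ring_scheme \<Rightarrow> 'a set \<Rightarrow> nat \<Rightarrow> 'a set"
  where "ideal_power A I n \<equiv> I [^]\<^bsub>ideals_set A\<^esub> n"

definition end_degree :: "('a, 'b) ring_scheme \<Rightarrow> 'a set \<Rightarrow> nat \<Rightarrow> bool"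
  where "end_degree A I u \<longleftrightarrow>
    ideal_power A I u \<noteq> {\<zero>\<^bsub>A\<^esub>} \<and> ideal_power A I (u + 1) = {\<zero>\<^bsub>A\<^esub>}"

text \<open>A graded module over \<open>G(I)\<close> is represented by the family of its homogeneous
  components, each a module over \<open>G(I)\<^sub>0 = A/I\<close>. The degree \<open>i\<close> component of
  \<open>G(I)\<close> itself is \<open>I\<^sup>i/I\<^sup>i\<^sup>+\<^sup>1\<close>, where \<open>a + I\<close> sends
  \<open>x + I\<^sup>i\<^sup>+\<^sup>1\<close> to \<open>a x + I\<^sup>i\<^sup>+\<^sup>1\<close>.\<close>

definition assoc_graded :: "('a, 'b) ring_scheme \<Rightarrow> 'a set \<Rightarrow> nat \<Rightarrow> ('a set, 'a set) module"
  where "assoc_graded A I i =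
    \<lparr>carrier = (\<lambda>x. ideal_power A I (i + 1) +>\<^bsub>A\<^esub> x) ` ideal_power A I i,
     mult = undefined, one = undefined,
     zero = ideal_power A I (i + 1), add = set_add A,
     smult = rcoset_mult A (ideal_power A I (i + 1))\<rparr>"

text \<open>The component \<open>C(a)\<^sub>i\<close>, as a subset of \<open>I\<^sup>i/I\<^sup>i\<^sup>+\<^sup>1\<close>: the image of
  \<open>(0 : I\<^sup>n) \<inter> I\<^sup>i\<close> with \<open>n = u + 1 - a - i\<close>. Truncated subtraction on \<^typ>\<open>nat\<close>
  implements the convention that \<open>I\<^sup>n = A\<close> for \<open>n \<le> 0\<close>.\<close>

definition C_part :: "('a, 'b) ring_scheme \<Rightarrow> 'a set \<Rightarrow> nat \<Rightarrow> nat \<Rightarrow> nat \<Rightarrow> 'a set set"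
  where "C_part A I u a i =
    (\<lambda>x. ideal_power A I (i + 1) +>\<^bsub>A\<^esub> x) `
      (annihilator A (ideal_power A I (u + 1 - a - i)) \<inter> ideal_power A I i)"

definition C_graded ::
    "('a, 'b) ring_scheme \<Rightarrow> 'a set \<Rightarrow> nat \<Rightarrow> nat \<Rightarrow> nat \<Rightarrow> ('a set, 'a set) module"
  where "C_graded A I u a i = (assoc_graded A I i)\<lparr>carrier := C_part A I u a i\<rparr>"

definition Q_graded ::
    "('a, 'b) ring_scheme \<Rightarrow> 'a set \<Rightarrow> nat \<Rightarrow> nat \<Rightarrow> nat \<Rightarrow> ('a set, 'a set set) module"
  where "Q_graded A I u a i = FactModule (C_graded A I u a i) (C_part A I u (a + 1) i)"

definition hilbert_function ::
    "('a, 'c) ring_scheme \<Rightarrow> (nat \<Rightarrow> ('a, 'b, 'd) module_scheme) \<Rightarrow> int \<Rightarrow> enat"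
  where "hilbert_function G0 S i = (if i < 0 then 0 else module_length G0 (S (nat i)))"

end

theory Submission
  imports Defs
begin

text \<open>All lengths are measured by chains in the modular lattice of ideals of \<open>A\<close>: the component
  \<open>Q(a)\<^sub>i\<close> corresponds, with \<open>j = u - a - i\<close>, to the interval
  \<open>[(I\<^sup>i \<inter> (0 : I\<^sup>j)) + (I\<^sup>i\<^sup>+\<^sup>1 \<inter> (0 : I\<^sup>j\<^sup>+\<^sup>1)), I\<^sup>i \<inter> (0 : I\<^sup>j\<^sup>+\<^sup>1)]\<close>.
  In an Artinian Gorenstein ring \<open>L \<mapsto> (0 : L)\<close> is an anti-automorphism of this lattice, and the
  image of the interval under it is matched by the butterfly (Zassenhaus) isomorphism with the
  interval in which \<open>i\<close> and \<open>j\<close> are exchanged. The formula for the Hilbert function of \<open>G(I)\<close> is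
  additivity of length along the filtration \<open>C(a)\<close>.\<close>

text \<open>The Gorenstein hypothesis says only that the socle has length one. The identity (0 : (0
  : L)) = L has to be extracted from it and the descending chain condition; it is also what makes
  the annihilator of an intersection a sum of annihilators. Put A = I^i, A' = I^(i+1), B = (0 :
  I^(j+1)), B' = (0 : I^j), as in \<open>interval_length_butterfly\<close>. Annihilation sends the
  interval to one whose lower end is (0 : A) + (0 : B), so sums appear where intersections are
  wanted. The Zassenhaus quotient also has a presentation by sums, and passing back to intersections
  gives an interval of the original shape. Since (0 : B) = I^(j+1) and (0 : B') = I^j, it is the
  interval with i and j exchanged. Working with intervals avoids building isomorphisms of quotient
  modules: each graded component is compared with an interval once, and later equalities come from
  strictly monotone maps between families of ideals. Lengths stay in \<open>enat\<close> and are
  never shown finite, so no argument subtracts them.\<close>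

no_notation Sum_Type.Plus (infixr "<+>" 65)

section \<open>Lengths of chains\<close>

text \<open>Stated for an arbitrary family of sets, so that submodules of a module and ideals in an
  interval, which live over different types, can be compared by the same lemmas.\<close>

definition chain_length :: "'a set set \<Rightarrow> enat"
  where "chain_length F =
    (SUP n \<in> {n. \<exists>N :: nat \<Rightarrow> 'a set. (\<forall>i\<le>n. N i \<in> F) \<and> (\<forall>i<n. N i \<subset> N (Suc i))}. enat n)"

lemma module_length_eq_chain_length: "module_length R M = chain_length {N. submodule N R M}"
  by (simp add: module_length_def chain_length_def)

lemma chain_length_upper:
  assumes "\<And>i. i \<le> n \<Longrightarrow> N i \<in> F" and "\<And>i. i < n \<Longrightarrow> N i \<subset> N (Suc i)"
  shows "enat n \<le> chain_length F"
  unfolding chain_length_def using assms by (intro SUP_upper) blast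

lemma chain_length_least:
  assumes "\<And>n N. \<lbrakk>\<And>i. i \<le> n \<Longrightarrow> N i \<in> F; \<And>i. i < n \<Longrightarrow> N i \<subset> N (Suc i)\<rbrakk> \<Longrightarrow> enat n \<le> c"
  shows "chain_length F \<le> c"
  unfolding chain_length_def using assms by (intro SUP_least) blast

text \<open>The supremum may be infinite and not attained, but every finite n below it is realized:
  if all chains were shorter than n = k + 1, then k would be an upper bound. A chain longer than n
  is truncated.\<close>

lemma enat_le_chain_lengthE:
  assumes "F \<noteq> {}" and "enat n \<le> chain_length F"
  obtains N where "\<And>i. i \<le> n \<Longrightarrow> N i \<in> F" and "\<And>i. i < n \<Longrightarrow> N i \<subset> N (Suc i)"
proof (cases n)
  case 0
  obtain X where "X \<in> F" using assms(1) by blast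
  with 0 show thesis by (intro that[of "\<lambda>_. X"]) auto
next
  case (Suc k)
  have "\<exists>m N. n \<le> m \<and> (\<forall>i\<le>m. N i \<in> F) \<and> (\<forall>i<m. N i \<subset> N (Suc i))"
  proof (rule ccontr)
    assume none: "\<not> ?thesis"
    have "chain_length F \<le> enat k"
    proof (rule chain_length_least)
      fix m and N :: "nat \<Rightarrow> 'a set"
      assume "\<And>i. i \<le> m \<Longrightarrow> N i \<in> F" "\<And>i. i < m \<Longrightarrow> N i \<subset> N (Suc i)"
      with none have "\<not> n \<le> m" by blast
      with Suc show "enat m \<le> enat k" by simp
    qed
    with assms(2) have "enat n \<le> enat k" by (rule order_trans)
    with Suc show False by simp
  qed
  then obtain m N where mN: "n \<le> m" "\<forall>i\<le>m. N i \<in> F" "\<forall>i<m. N i \<subset> N (Suc i)" by blast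
  show thesis
  proof (rule that)
    show "N i \<in> F" if "i \<le> n" for i using mN(1,2) that by auto
    show "N i \<subset> N (Suc i)" if "i < n" for i using mN(1,3) that by auto
  qed
qed

text \<open>Only chains are transported, so strict monotonicity suffices. Equalities of lengths
  below come from two such maps in opposite directions, with no proof that they are mutually
  inverse.\<close>

lemma chain_length_le_mono:
  assumes "\<And>K. K \<in> F \<Longrightarrow> f K \<in> G"
    and "\<And>K L. \<lbrakk>K \<in> F; L \<in> F; K \<subset> L\<rbrakk> \<Longrightarrow> f K \<subset> f L"
  shows "chain_length F \<le> chain_length G"
proof (rule chain_length_least)
  fix n N
  assume "\<And>i. i \<le> n \<Longrightarrow> N i \<in> F" "\<And>i. i < n \<Longrightarrow> N i \<subset> N (Suc i)"
  then show "enat n \<le> chain_length G"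
    using assms by (intro chain_length_upper[where N = "\<lambda>i. f (N i)"]) auto
qed

lemma chain_length_le_antimono:
  assumes "\<And>K. K \<in> F \<Longrightarrow> f K \<in> G"
    and "\<And>K L. \<lbrakk>K \<in> F; L \<in> F; K \<subset> L\<rbrakk> \<Longrightarrow> f L \<subset> f K"
  shows "chain_length F \<le> chain_length G"
proof (rule chain_length_least)
  fix n N
  assume N: "\<And>i. i \<le> n \<Longrightarrow> N i \<in> F" "\<And>i. i < n \<Longrightarrow> N i \<subset> N (Suc i)"
  show "enat n \<le> chain_length G"
  proof (rule chain_length_upper[where N = "\<lambda>i. f (N (n - i))"])
    show "f (N (n - i)) \<in> G" for i using N(1) assms(1) by simp
    show "f (N (n - i)) \<subset> f (N (n - Suc i))" if "i < n" for i
    proof (rule assms(2))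
      show "N (n - Suc i) \<subset> N (n - i)"
        using N(2)[of "n - Suc i"] that by (simp add: Suc_diff_Suc)
    qed (use N(1) in auto)
  qed
qed

text \<open>Deleting the repetitions from a weakly increasing chain leaves one strict step per
  proper inclusion.\<close>

lemma card_strict_steps_le_chain_length:
  assumes "\<And>i. i \<le> n \<Longrightarrow> K i \<in> F" and "\<And>i. i < n \<Longrightarrow> K i \<subseteq> K (Suc i)"
  shows "enat (card {i. i < n \<and> K i \<noteq> K (Suc i)}) \<le> chain_length F"
proof -
  \<comment> \<open>The last conjunct strengthens the induction: the thinned chain must end in
    \<open>K n\<close> so that \<open>K (Suc n)\<close> can be appended.\<close>
  have "\<exists>N. (\<forall>i\<le>card {i. i < n \<and> K i \<noteq> K (Suc i)}. N i \<in> F)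
      \<and> (\<forall>i<card {i. i < n \<and> K i \<noteq> K (Suc i)}. N i \<subset> N (Suc i))
      \<and> N (card {i. i < n \<and> K i \<noteq> K (Suc i)}) = K n"
    using assms
  proof (induction n)
    case 0
    then show ?case by (intro exI[of _ "\<lambda>_. K 0"]) simp
  next
    case (Suc n)
    let ?c = "card {i. i < n \<and> K i \<noteq> K (Suc i)}"
    obtain N where N: "\<forall>i\<le>?c. N i \<in> F" "\<forall>i<?c. N i \<subset> N (Suc i)" "N ?c = K n"
      using Suc.IH Suc.prems by auto
    show ?case
    proof (cases "K n = K (Suc n)")
      case True
      then have "{i. i < Suc n \<and> K i \<noteq> K (Suc i)} = {i. i < n \<and> K i \<noteq> K (Suc i)}"
        using less_Suc_eq by auto
      with N True show ?thesis by (intro exI[of _ N]) simp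
    next
      case False
      then have "{i. i < Suc n \<and> K i \<noteq> K (Suc i)} = insert n {i. i < n \<and> K i \<noteq> K (Suc i)}"
        using less_Suc_eq by auto
      then have c: "card {i. i < Suc n \<and> K i \<noteq> K (Suc i)} = Suc ?c" by simp
      have step: "K n \<subset> K (Suc n)" using Suc.prems(2)[of n] False by auto
      show ?thesis
        unfolding c
      proof (intro exI[of _ "N(Suc ?c := K (Suc n))"] conjI allI impI)
        show "(N(Suc ?c := K (Suc n))) i \<in> F" if "i \<le> Suc ?c" for i
          using that N(1) Suc.prems(1)[of "Suc n"] by (cases "i = Suc ?c") auto
        show "(N(Suc ?c := K (Suc n))) i \<subset> (N(Suc ?c := K (Suc n))) (Suc i)" if "i < Suc ?c" for i
          using that N(2,3) step by (cases "i = ?c") auto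
      qed simp
    qed
  qed
  then obtain N where "\<forall>i\<le>card {i. i < n \<and> K i \<noteq> K (Suc i)}. N i \<in> F"
    and "\<forall>i<card {i. i < n \<and> K i \<noteq> K (Suc i)}. N i \<subset> N (Suc i)" by auto
  then show ?thesis by (intro chain_length_upper[where N = N]) simp_all
qed

lemma chain_length_singleton: "chain_length {X} = 0"
proof -
  have "chain_length {X} \<le> 0"
  proof (rule chain_length_least)
    fix n and N :: "nat \<Rightarrow> 'a set"
    assume N: "\<And>i. i \<le> n \<Longrightarrow> N i \<in> {X}" "\<And>i. i < n \<Longrightarrow> N i \<subset> N (Suc i)"
    show "enat n \<le> 0"
    proof (cases n)
      case (Suc k)
      then show ?thesis using N(1)[of 0] N(1)[of 1] N(2)[of 0] by auto
    qed (simp add: zero_enat_def)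
  qed
  then show ?thesis by simp
qed

section \<open>Intervals in the lattice of ideals\<close>

text \<open>For ideals X contained in Y this is the length of Y/X, by the correspondence between its
  submodules and the ideals in between.\<close>

definition interval_length :: "('a, 'b) ring_scheme \<Rightarrow> 'a set \<Rightarrow> 'a set \<Rightarrow> enat"
  where "interval_length R X Y = chain_length {K. ideal K R \<and> X \<subseteq> K \<and> K \<subseteq> Y}"

lemma (in ring) interval_length_refl: "ideal X R \<Longrightarrow> interval_length R X X = 0"
proof -
  assume "ideal X R"
  then have "{K. ideal K R \<and> X \<subseteq> K \<and> K \<subseteq> X} = {X}" by auto
  then show ?thesis by (simp add: interval_length_def chain_length_singleton)
qed

section \<open>Sums and intersections of ideals, additivity of length, isomorphism theorems\<close>

context cring
begin

lemma mem_set_add_iff: "x \<in> K <+> L \<longleftrightarrow> (\<exists>k\<in>K. \<exists>l\<in>L. x = k \<oplus> l)"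
  by (auto simp: set_add_def')

lemma ideal_zero_mem: "ideal K R \<Longrightarrow> \<zero> \<in> K"
  by (simp add: additive_subgroup.zero_closed ideal.axioms(1))

lemma ideal_add_mem: "\<lbrakk>ideal K R; x \<in> K; y \<in> K\<rbrakk> \<Longrightarrow> x \<oplus> y \<in> K"
  by (simp add: additive_subgroup.a_closed ideal.axioms(1))

lemma ideal_neg_mem: "\<lbrakk>ideal K R; x \<in> K\<rbrakk> \<Longrightarrow> \<ominus> x \<in> K"
  by (simp add: additive_subgroup.a_inv_closed ideal.axioms(1))

lemma ideal_minus_mem: "\<lbrakk>ideal K R; x \<in> K; y \<in> K\<rbrakk> \<Longrightarrow> x \<ominus> y \<in> K"
  by (simp add: a_minus_def ideal_add_mem ideal_neg_mem)

lemma ideal_add_cancel: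
  assumes "ideal K R" "x \<in> carrier R" "y \<in> K" "x \<oplus> y \<in> K"
  shows "x \<in> K"
proof -
  have "y \<in> carrier R" using assms ideal.Icarr by fast
  then have "x = (x \<oplus> y) \<ominus> y" using assms(2) by algebra
  then show ?thesis using ideal_minus_mem[OF assms(1,4,3)] by simp
qed

lemma ideal_add_cancel_left:
  assumes "ideal K R" "x \<in> K" "y \<in> carrier R" "x \<oplus> y \<in> K"
  shows "y \<in> K"
  using ideal_add_cancel[OF assms(1,3,2)] assms ideal.Icarr[OF assms(1,2)] by (simp add: a_comm)

lemma set_add_upper1:
  assumes "ideal K R" "ideal L R"
  shows "K \<subseteq> K <+> L"
proof
  fix k assume "k \<in> K"
  moreover from this have "k = k \<oplus> \<zero>" using assms ideal.Icarr by force
  ultimately show "k \<in> K <+> L" unfolding mem_set_add_iff using assms ideal_zero_mem by blast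
qed

lemma set_add_upper2:
  assumes "ideal K R" "ideal L R"
  shows "L \<subseteq> K <+> L"
proof
  fix k assume "k \<in> L"
  moreover from this have "k = \<zero> \<oplus> k" using assms ideal.Icarr by force
  ultimately show "k \<in> K <+> L" unfolding mem_set_add_iff using assms ideal_zero_mem by blast
qed

lemma set_add_mono: "\<lbrakk>K \<subseteq> K'; L \<subseteq> L'\<rbrakk> \<Longrightarrow> K <+> L \<subseteq> K' <+> L'"
  unfolding set_add_def' by blast

lemma set_add_least: "\<lbrakk>ideal N R; K \<subseteq> N; L \<subseteq> N\<rbrakk> \<Longrightarrow> K <+> L \<subseteq> N"
  by (auto simp: mem_set_add_iff intro!: ideal_add_mem)

lemma ideal_modular_law:
  assumes "ideal K R" "ideal L R" "ideal N R" "K \<subseteq> N"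
  shows "N \<inter> (K <+> L) = K <+> (N \<inter> L)"
proof
  show "N \<inter> (K <+> L) \<subseteq> K <+> (N \<inter> L)"
  proof
    fix x assume x: "x \<in> N \<inter> (K <+> L)"
    then obtain k l where kl: "k \<in> K" "l \<in> L" "x = k \<oplus> l" by (auto simp: mem_set_add_iff)
    have "l \<in> N"
      using ideal_add_cancel_left[OF assms(3), of k l] x kl assms ideal.Icarr[OF assms(2)] by auto
    then show "x \<in> K <+> (N \<inter> L)" using kl by (auto simp: mem_set_add_iff)
  qed
  show "K <+> (N \<inter> L) \<subseteq> N \<inter> (K <+> L)"
    using assms ideal_add_mem[OF assms(3)] by (fastforce simp: mem_set_add_iff)
qed

text \<open>Cancellation in a modular lattice: write l = k + y; then y = l - k lies in L and Y,
  hence in K. It guarantees that a strict step of a chain stays strict after intersecting with Y or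
  after adding Y.\<close>

lemma ideal_eq_if_inter_eq_and_add_eq:
  assumes "ideal K R" "ideal L R" "ideal Y R" "K \<subseteq> L"
    and "K \<inter> Y = L \<inter> Y" "K <+> Y = L <+> Y"
  shows "K = L"
proof
  show "L \<subseteq> K"
  proof
    fix l assume l: "l \<in> L"
    then have "l \<in> K <+> Y" using set_add_upper1[OF assms(2,3)] assms(6) by auto
    then obtain k y where ky: "k \<in> K" "y \<in> Y" "l = k \<oplus> y" by (auto simp: mem_set_add_iff)
    then have "y \<in> L"
      using ideal_add_cancel_left[OF assms(2), of k y] l assms(4) ideal.Icarr[OF assms(3)] by auto
    then have "y \<in> K" using ky assms(5) by auto
    then show "l \<in> K" using ky ideal_add_mem[OF assms(1)] by auto
  qed
qed fact

text \<open>A chain from X to Z is split into its intersections with Y and its sums with Y; each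
  strict step survives in at least one of the two, which bounds its length. Conversely, chains below
  and above Y are concatenated.\<close>

lemma interval_length_split:
  assumes "ideal X R" "ideal Y R" "ideal Z R" "X \<subseteq> Y" "Y \<subseteq> Z"
  shows "interval_length R X Z = interval_length R X Y + interval_length R Y Z"
proof (rule antisym)
  show "interval_length R X Z \<le> interval_length R X Y + interval_length R Y Z"
    unfolding interval_length_def
  proof (rule chain_length_least)
    fix n N
    assume N0: "\<And>i. i \<le> n \<Longrightarrow> N i \<in> {K. ideal K R \<and> X \<subseteq> K \<and> K \<subseteq> Z}"
      and N: "\<And>i. i < n \<Longrightarrow> N i \<subset> N (Suc i)"
    let ?P = "\<lambda>i. N i \<inter> Y" and ?S = "\<lambda>i. N i <+> Y"
    let ?p = "{i. i < n \<and> ?P i \<noteq> ?P (Suc i)}" and ?s = "{i. i < n \<and> ?S i \<noteq> ?S (Suc i)}"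
    have id: "ideal (N i) R" if "i \<le> n" for i using N0 that by blast
    have "{..<n} \<subseteq> ?p \<union> ?s"
    proof
      fix i assume "i \<in> {..<n}"
      with N[of i] id[of i] id[of "Suc i"] show "i \<in> ?p \<union> ?s"
        using ideal_eq_if_inter_eq_and_add_eq[of "N i" "N (Suc i)" Y] assms(2) by auto
    qed
    then have "card {..<n} \<le> card (?p \<union> ?s)" by (intro card_mono) auto
    also have "\<dots> \<le> card ?p + card ?s" by (rule card_Un_le)
    finally have "enat n \<le> enat (card ?p) + enat (card ?s)" by simp
    also have "\<dots> \<le> chain_length {K. ideal K R \<and> X \<subseteq> K \<and> K \<subseteq> Y}
        + chain_length {K. ideal K R \<and> Y \<subseteq> K \<and> K \<subseteq> Z}"
    proof (intro add_mono card_strict_steps_le_chain_length)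
      show "?P i \<in> {K. ideal K R \<and> X \<subseteq> K \<and> K \<subseteq> Y}" if "i \<le> n" for i
        using N0[OF that] assms i_intersect by auto
      show "?P i \<subseteq> ?P (Suc i)" if "i < n" for i using N[OF that] by auto
      show "?S i \<in> {K. ideal K R \<and> Y \<subseteq> K \<and> K \<subseteq> Z}" if "i \<le> n" for i
        using N0[OF that] add_ideals[OF id[OF that] assms(2)] set_add_upper2[OF id[OF that] assms(2)]
          set_add_least[OF assms(3) _ assms(5)] by auto
      show "?S i \<subseteq> ?S (Suc i)" if "i < n" for i
        using N[OF that] by (intro set_add_mono) auto
    qed
    finally show "enat n \<le> \<dots>" .
  qed
next
  let ?F = "{K. ideal K R \<and> X \<subseteq> K \<and> K \<subseteq> Y}" and ?G = "{K. ideal K R \<and> Y \<subseteq> K \<and> K \<subseteq> Z}"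
  have glue: "enat (n + m) \<le> interval_length R X Z"
    if nm: "enat n \<le> chain_length ?F" "enat m \<le> chain_length ?G" for n m
  proof -
    have ne: "?F \<noteq> {}" "?G \<noteq> {}" using assms by blast+
    obtain K where K: "\<And>i. i \<le> n \<Longrightarrow> K i \<in> ?F" "\<And>i. i < n \<Longrightarrow> K i \<subset> K (Suc i)"
      using enat_le_chain_lengthE[OF ne(1) nm(1)] by blast
    obtain L where L: "\<And>i. i \<le> m \<Longrightarrow> L i \<in> ?G" "\<And>i. i < m \<Longrightarrow> L i \<subset> L (Suc i)"
      using enat_le_chain_lengthE[OF ne(2) nm(2)] by blast
    \<comment> \<open>The glued chain goes from \<open>K n\<close> straight to \<open>L 1\<close>.
      Skipping \<open>L 0\<close> keeps the step strict, since \<open>K n\<close> and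
      \<open>L 0\<close> may both equal Y.\<close>
    let ?N = "\<lambda>i. if i \<le> n then K i else L (i - n)"
    show ?thesis
      unfolding interval_length_def
    proof (rule chain_length_upper[where N = ?N])
      show "?N i \<in> {K. ideal K R \<and> X \<subseteq> K \<and> K \<subseteq> Z}" if "i \<le> n + m" for i
      proof (cases "i \<le> n")
        case True
        then show ?thesis using K(1)[of i] assms(5) by auto
      next
        case False
        then have "L (i - n) \<in> ?G" using L(1)[of "i - n"] that by simp
        with False show ?thesis using assms(4) by auto
      qed
      show "?N i \<subset> ?N (Suc i)" if "i < n + m" for i
      proof -
        consider "i < n" | "i = n" | "n < i" by linarith
        then show ?thesis
        proof cases
          case 1
          then show ?thesis using K(2) by simp
        next
          case 2
          then have "K n \<subseteq> L 0" "L 0 \<subset> L 1" using K(1)[of n] L(1)[of 0] L(2)[of 0] that by auto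
          with 2 show ?thesis by auto
        next
          case 3
          then show ?thesis using L(2)[of "i - n"] that by (simp add: Suc_diff_le)
        qed
      qed
    qed
  qed
  have "chain_length ?F + chain_length ?G \<le> interval_length R X Z"
  proof (rule ccontr)
    assume "\<not> chain_length ?F + chain_length ?G \<le> interval_length R X Z"
    then obtain c where c: "interval_length R X Z = enat c" "enat c < chain_length ?F + chain_length ?G"
      by (cases "interval_length R X Z") auto
    \<comment> \<open>If one length is infinite, a chain of length c + 1 on that side and a trivial
      one on the other already exceed c.\<close>
    have "\<exists>n m. enat n \<le> chain_length ?F \<and> enat m \<le> chain_length ?G \<and> c < n + m"
    proof (cases "chain_length ?F")
      case (enat f)
      show ?thesis
      proof (cases "chain_length ?G")
        case (enat g)
        with \<open>chain_length ?F = enat f\<close> c show ?thesis by (intro exI[of _ f] exI[of _ g]) auto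
      next
        case infinity
        show ?thesis
          unfolding infinity by (intro exI[of _ 0] exI[of _ "Suc c"]) (simp flip: zero_enat_def)
      qed
    next
      case infinity
      show ?thesis
        unfolding infinity by (intro exI[of _ "Suc c"] exI[of _ 0]) (simp flip: zero_enat_def)
    qed
    then obtain n m where "enat n \<le> chain_length ?F" "enat m \<le> chain_length ?G" "c < n + m"
      by blast
    with glue[of n m] c show False by simp
  qed
  then show "interval_length R X Y + interval_length R Y Z \<le> interval_length R X Z"
    by (simp add: interval_length_def)
qed

text \<open>Second isomorphism theorem. Both maps are strict by cancellation: all K on the left meet
  W in P \<inter> W, and all K on the right have the same sum with P.\<close>

lemma interval_length_diamond:
  assumes "ideal P R" "ideal W R"
  shows "interval_length R (P \<inter> W) P = interval_length R W (P <+> W)"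
  unfolding interval_length_def
proof (rule antisym)
  show "chain_length {K. ideal K R \<and> P \<inter> W \<subseteq> K \<and> K \<subseteq> P}
      \<le> chain_length {K. ideal K R \<and> W \<subseteq> K \<and> K \<subseteq> P <+> W}"
  proof (rule chain_length_le_mono[where f = "\<lambda>K. K <+> W"])
    fix K assume K: "K \<in> {K. ideal K R \<and> P \<inter> W \<subseteq> K \<and> K \<subseteq> P}"
    then show "K <+> W \<in> {K. ideal K R \<and> W \<subseteq> K \<and> K \<subseteq> P <+> W}"
      using assms add_ideals[of K W] set_add_upper2[of K W] set_add_mono[of K P W W] by auto
    fix L assume L: "L \<in> {K. ideal K R \<and> P \<inter> W \<subseteq> K \<and> K \<subseteq> P}" and KL: "K \<subset> L"
    have "K <+> W \<noteq> L <+> W"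
    proof
      assume "K <+> W = L <+> W"
      moreover have "K \<inter> W = L \<inter> W" using K L by auto
      ultimately show False
        using ideal_eq_if_inter_eq_and_add_eq[of K L W] K L KL assms by auto
    qed
    moreover have "K <+> W \<subseteq> L <+> W" using KL by (intro set_add_mono) auto
    ultimately show "K <+> W \<subset> L <+> W" by auto
  qed
  show "chain_length {K. ideal K R \<and> W \<subseteq> K \<and> K \<subseteq> P <+> W}
      \<le> chain_length {K. ideal K R \<and> P \<inter> W \<subseteq> K \<and> K \<subseteq> P}"
  proof (rule chain_length_le_mono[where f = "\<lambda>K. K \<inter> P"])
    fix K assume K: "K \<in> {K. ideal K R \<and> W \<subseteq> K \<and> K \<subseteq> P <+> W}"
    then show "K \<inter> P \<in> {K. ideal K R \<and> P \<inter> W \<subseteq> K \<and> K \<subseteq> P}"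
      using assms i_intersect[of K P] by auto
    fix L assume L: "L \<in> {K. ideal K R \<and> W \<subseteq> K \<and> K \<subseteq> P <+> W}" and KL: "K \<subset> L"
    have "N <+> P = P <+> W" if "ideal N R" "W \<subseteq> N" "N \<subseteq> P <+> W" for N
    proof
      show "N <+> P \<subseteq> P <+> W"
        using that assms set_add_least[OF add_ideals[OF assms]] set_add_upper1[OF assms] by auto
      show "P <+> W \<subseteq> N <+> P"
        using that assms set_add_least[OF add_ideals[OF that(1) assms(1)]]
          set_add_upper1[OF that(1) assms(1)] set_add_upper2[OF that(1) assms(1)] by auto
    qed
    then have "K <+> P = L <+> P" using K L by auto
    then have "K \<inter> P \<noteq> L \<inter> P"
      using ideal_eq_if_inter_eq_and_add_eq[of K L P] K L KL assms by auto
    then show "K \<inter> P \<subset> L \<inter> P" using KL by auto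
  qed
qed

text \<open>The diamond for P = A \<inter> B and W = A' + B', once meet and join are computed. The
  right side is the form in which annihilators of the left side appear.\<close>

lemma interval_length_butterfly:
  assumes "ideal A R" "ideal A' R" "ideal B R" "ideal B' R" "A' \<subseteq> A" "B' \<subseteq> B"
  shows "interval_length R ((A \<inter> B') <+> (A' \<inter> B)) (A \<inter> B)
    = interval_length R (A' <+> B') ((A <+> B') \<inter> (A' <+> B))"
proof -
  note ideals = assms(1-4) i_intersect add_ideals
  have W: "ideal (A' <+> B') R" and P: "ideal (A \<inter> B) R" by (simp_all add: ideals)
  have "(A \<inter> B) \<inter> (A' <+> B') = (A \<inter> B') <+> (A' \<inter> B)"
  proof
    show "(A \<inter> B) \<inter> (A' <+> B') \<subseteq> (A \<inter> B') <+> (A' \<inter> B)"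
    proof
      fix x assume x: "x \<in> (A \<inter> B) \<inter> (A' <+> B')"
      then obtain a b where ab: "a \<in> A'" "b \<in> B'" "x = a \<oplus> b" by (auto simp: mem_set_add_iff)
      have carr: "a \<in> carrier R" "b \<in> carrier R" using ab assms ideal.Icarr by fast+
      have "b \<in> A" using ideal_add_cancel_left[of A a b] ab x carr assms by auto
      moreover have "a \<in> B" using ideal_add_cancel[of B a b] ab x carr assms by auto
      moreover have "x = b \<oplus> a" using ab carr by (simp add: a_comm)
      ultimately show "x \<in> (A \<inter> B') <+> (A' \<inter> B)"
        using ab by (auto simp: mem_set_add_iff)
    qed
    show "(A \<inter> B') <+> (A' \<inter> B) \<subseteq> (A \<inter> B) \<inter> (A' <+> B')"
    proof (rule set_add_least)
      show "ideal ((A \<inter> B) \<inter> (A' <+> B')) R" by (rule i_intersect[OF P W])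
      show "A \<inter> B' \<subseteq> (A \<inter> B) \<inter> (A' <+> B')" "A' \<inter> B \<subseteq> (A \<inter> B) \<inter> (A' <+> B')"
        using set_add_upper1[OF assms(2,4)] set_add_upper2[OF assms(2,4)] assms(5,6) by blast+
    qed
  qed
  moreover have "(A \<inter> B) <+> (A' <+> B') = (A <+> B') \<inter> (A' <+> B)"
  proof
    show "(A \<inter> B) <+> (A' <+> B') \<subseteq> (A <+> B') \<inter> (A' <+> B)"
    proof (rule set_add_least)
      show "ideal ((A <+> B') \<inter> (A' <+> B)) R" by (simp add: ideals)
      show "A \<inter> B \<subseteq> (A <+> B') \<inter> (A' <+> B)"
        using set_add_upper1[OF assms(1,4)] set_add_upper2[OF assms(2,3)] by auto
      show "A' <+> B' \<subseteq> (A <+> B') \<inter> (A' <+> B)"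
        using assms(5,6) by (simp add: set_add_mono)
    qed
    show "(A <+> B') \<inter> (A' <+> B) \<subseteq> (A \<inter> B) <+> (A' <+> B')"
    proof
      fix x assume "x \<in> (A <+> B') \<inter> (A' <+> B)"
      then obtain a b a' b' where ab: "a \<in> A" "b' \<in> B'" "x = a \<oplus> b'" "a' \<in> A'" "b \<in> B" "x = a' \<oplus> b"
        by (auto simp: mem_set_add_iff)
      have carr: "a \<in> carrier R" "b \<in> carrier R" "a' \<in> carrier R" "b' \<in> carrier R"
        using ab assms ideal.Icarr by fast+
      \<comment> \<open>Equating the two representations of x shows a - a' = b - b', an element of
        both A and B.\<close>
      have "a \<ominus> a' = (a \<oplus> b') \<ominus> b' \<ominus> a'" using carr by algebra
      also have "\<dots> = (a' \<oplus> b) \<ominus> b' \<ominus> a'" using ab by simp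
      also have "\<dots> = b \<ominus> b'" using carr by algebra
      finally have "a \<ominus> a' = b \<ominus> b'" .
      moreover have "a \<ominus> a' \<in> A" using ideal_minus_mem ab assms by blast
      moreover have "b \<ominus> b' \<in> B" using ideal_minus_mem ab assms by blast
      ultimately have "a \<ominus> a' \<in> A \<inter> B" by simp
      moreover have "x = (a \<ominus> a') \<oplus> (a' \<oplus> b')" unfolding ab(3) using carr by algebra
      moreover have "a' \<oplus> b' \<in> A' <+> B'" using ab by (auto simp: mem_set_add_iff)
      ultimately show "x \<in> (A \<inter> B) <+> (A' <+> B')" using mem_set_add_iff[of x "A \<inter> B"] by blast
    qed
  qed
  ultimately show ?thesis using interval_length_diamond[OF P W] by simp
qed

end

section \<open>Module lengths as interval lengths\<close>

lemma (in cring) idealI_comm: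
  assumes "K \<subseteq> carrier R" "\<zero> \<in> K" "\<And>x y. \<lbrakk>x \<in> K; y \<in> K\<rbrakk> \<Longrightarrow> x \<oplus> y \<in> K"
    and "\<And>r x. \<lbrakk>r \<in> carrier R; x \<in> K\<rbrakk> \<Longrightarrow> r \<otimes> x \<in> K"
  shows "ideal K R"
proof (rule idealI[OF ring_axioms])
  show "subgroup K (add_monoid R)"
  proof (rule add.subgroupI)
    show "\<ominus> x \<in> K" if "x \<in> K" for x
    proof -
      have "x \<in> carrier R" using assms(1) that by auto
      then have "(\<ominus> \<one>) \<otimes> x = \<ominus> x" by (simp add: l_minus)
      then show ?thesis using assms(4)[OF _ that, of "\<ominus> \<one>"] by simp
    qed
  qed (use assms in auto)
  show "x \<otimes> a \<in> K" "a \<otimes> x \<in> K" if "a \<in> K" "x \<in> carrier R" for a x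
    using assms(4)[OF that(2,1)] subsetD[OF assms(1) that(1)] that(2) by (simp_all add: m_comm)
qed

text \<open>Here \<phi> is a surjection from Y onto P, semilinear along \<rho>. Preimages of
  submodules increase strictly because \<phi> is onto, images of ideals because these contain the
  kernel.\<close>

lemma (in cring) module_length_image:
  fixes S :: "('c, 'd) ring_scheme" and P :: "('c, 'e, 'f) module_scheme"
  assumes Y: "ideal Y R"
    and \<rho>: "\<rho> ` carrier R = carrier S"
    and \<phi>: "\<phi> ` Y = carrier P"
    and add: "\<And>x y. \<lbrakk>x \<in> Y; y \<in> Y\<rbrakk> \<Longrightarrow> \<phi> (x \<oplus> y) = \<phi> x \<oplus>\<^bsub>P\<^esub> \<phi> y"
    and smult: "\<And>r x. \<lbrakk>r \<in> carrier R; x \<in> Y\<rbrakk> \<Longrightarrow> \<phi> (r \<otimes> x) = \<rho> r \<odot>\<^bsub>P\<^esub> \<phi> x"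
    and zero: "\<phi> \<zero> = \<zero>\<^bsub>P\<^esub>"
  shows "module_length S P = interval_length R {x \<in> Y. \<phi> x = \<zero>\<^bsub>P\<^esub>} Y"
proof -
  let ?X = "{x \<in> Y. \<phi> x = \<zero>\<^bsub>P\<^esub>}" and ?G = "add_monoid R\<lparr>carrier := Y\<rparr>"
  have subY: "subgroup Y (add_monoid R)"
    using Y by (simp add: additive_subgroup.a_subgroup ideal.axioms(1))
  have grp: "group ?G" by (rule add.subgroup_imp_group[OF subY])
  \<comment> \<open>The group structure of P is inherited from Y as a homomorphic image; it supplies
    the additive inverses that submodules must contain.\<close>
  have "\<phi> \<in> hom ?G (add_monoid P)" using \<phi> add by (auto simp: hom_def)
  from group.hom_imp_img_group[OF grp this]
  have "group (add_monoid P\<lparr>carrier := carrier P, one := \<zero>\<^bsub>P\<^esub>\<rparr>)" by (simp add: \<phi> zero)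
  then interpret P: group "add_monoid P" by simp
  have neg: "inv\<^bsub>add_monoid P\<^esub> (\<phi> x) = \<phi> (\<ominus> x)" if "x \<in> Y" for x
  proof (rule P.inv_equality)
    have "\<ominus> x \<in> Y" "x \<in> carrier R" using that Y ideal_neg_mem ideal.Icarr by auto
    then show "\<phi> (\<ominus> x) \<otimes>\<^bsub>add_monoid P\<^esub> \<phi> x = \<one>\<^bsub>add_monoid P\<^esub>"
      using add[of "\<ominus> x" x] that zero by (simp add: l_neg)
    show "\<phi> x \<in> carrier (add_monoid P)" "\<phi> (\<ominus> x) \<in> carrier (add_monoid P)"
      using \<phi> that \<open>\<ominus> x \<in> Y\<close> by auto
  qed
  let ?F = "{N. submodule N S P}" and ?H = "{K. ideal K R \<and> ?X \<subseteq> K \<and> K \<subseteq> Y}"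
  have "chain_length ?F \<le> chain_length ?H"
  proof (rule chain_length_le_mono[where f = "\<lambda>N. {x \<in> Y. \<phi> x \<in> N}"])
    fix N assume "N \<in> ?F"
    then interpret N: submodule N S P by simp
    have "ideal {x \<in> Y. \<phi> x \<in> N} R"
    proof (rule idealI_comm)
      show "{x \<in> Y. \<phi> x \<in> N} \<subseteq> carrier R" using Y ideal.Icarr by fast
      show "\<zero> \<in> {x \<in> Y. \<phi> x \<in> N}" using zero Y ideal_zero_mem N.one_closed by simp
      show "x \<oplus> y \<in> {x \<in> Y. \<phi> x \<in> N}"
        if "x \<in> {x \<in> Y. \<phi> x \<in> N}" "y \<in> {x \<in> Y. \<phi> x \<in> N}" for x y
        using that add Y ideal_add_mem N.m_closed by simp
      show "r \<otimes> x \<in> {x \<in> Y. \<phi> x \<in> N}" if "r \<in> carrier R" "x \<in> {x \<in> Y. \<phi> x \<in> N}" for r x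
        using that smult Y ideal.I_l_closed N.smult_closed \<rho> by fastforce
    qed
    then show "{x \<in> Y. \<phi> x \<in> N} \<in> ?H" using N.one_closed by auto
    fix N' assume "N' \<in> ?F" and NN': "N \<subset> N'"
    then interpret N': submodule N' S P by simp
    obtain z where z: "z \<in> N'" "z \<notin> N" using NN' by blast
    then obtain x where "x \<in> Y" "z = \<phi> x" using N'.subset \<phi> by auto
    then show "{x \<in> Y. \<phi> x \<in> N} \<subset> {x \<in> Y. \<phi> x \<in> N'}" using z NN' by auto
  qed
  moreover have "chain_length ?H \<le> chain_length ?F"
  proof (rule chain_length_le_mono[where f = "\<lambda>K. \<phi> ` K"])
    fix K assume K: "K \<in> ?H"
    then have idK: "ideal K R" and KY: "K \<subseteq> Y" and XK: "?X \<subseteq> K" by auto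
    have "submodule (\<phi> ` K) S P"
    proof (intro submodule.intro subgroup.intro submodule_axioms.intro)
      show "\<phi> ` K \<subseteq> carrier (add_monoid P)" using KY \<phi> by auto
      show "x \<otimes>\<^bsub>add_monoid P\<^esub> y \<in> \<phi> ` K" if xy: "x \<in> \<phi> ` K" "y \<in> \<phi> ` K" for x y
      proof -
        obtain k l where "k \<in> K" "l \<in> K" "x = \<phi> k" "y = \<phi> l" using xy by blast
        with idK KY show ?thesis using add[of k l] ideal_add_mem[of K k l] by force
      qed
      show "\<one>\<^bsub>add_monoid P\<^esub> \<in> \<phi> ` K" using zero idK ideal_zero_mem by force
      show "inv\<^bsub>add_monoid P\<^esub> x \<in> \<phi> ` K" if "x \<in> \<phi> ` K" for x
        using that neg idK KY ideal_neg_mem by auto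
      show "a \<odot>\<^bsub>P\<^esub> x \<in> \<phi> ` K" if ax: "a \<in> carrier S" "x \<in> \<phi> ` K" for a x
      proof -
        obtain r k where "r \<in> carrier R" "a = \<rho> r" "k \<in> K" "x = \<phi> k" using ax \<rho> by blast
        with idK KY show ?thesis using smult[of r k] ideal.I_l_closed[of K R k r] by force
      qed
    qed
    then show "\<phi> ` K \<in> ?F" by simp
    fix L assume L: "L \<in> ?H" and KL: "K \<subset> L"
    obtain l where l: "l \<in> L" "l \<notin> K" using KL by auto
    have "\<phi> l \<notin> \<phi> ` K"
    proof
      assume "\<phi> l \<in> \<phi> ` K"
      then obtain k where k: "k \<in> K" "\<phi> l = \<phi> k" by auto
      have kl: "k \<in> Y" "l \<in> Y" "\<ominus> k \<in> Y" using k l K L Y ideal_neg_mem by auto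
      then have "\<phi> (l \<oplus> \<ominus> k) = \<phi> (k \<oplus> \<ominus> k)" using add k by simp
      also have "\<dots> = \<zero>\<^bsub>P\<^esub>" using kl(1) Y ideal.Icarr zero by (metis r_neg)
      finally have "l \<oplus> \<ominus> k \<in> K" using XK kl Y ideal_add_mem by auto
      then have "l \<in> K"
        using ideal_add_cancel[OF idK, of l "\<ominus> k"] ideal.Icarr[OF Y kl(2)] ideal_neg_mem[OF idK k(1)] by auto
      with l show False by simp
    qed
    then show "\<phi> ` K \<subset> \<phi> ` L" using KL l by blast
  qed
  ultimately show ?thesis
    unfolding module_length_eq_chain_length interval_length_def by (rule antisym)
qed

lemma (in cring) module_length_ideal_module:
  assumes "ideal L R"
  shows "module_length R (ideal_module R L) = interval_length R {\<zero>} L"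
proof -
  have "module_length R (ideal_module R L)
      = interval_length R {x \<in> L. id x = \<zero>\<^bsub>ideal_module R L\<^esub>} L"
    by (rule module_length_image[where \<rho> = id]) (use assms in \<open>auto simp: ideal_module_def\<close>)
  moreover have "{x \<in> L. id x = \<zero>\<^bsub>ideal_module R L\<^esub>} = {\<zero>}"
    using ideal_zero_mem[OF assms] by (auto simp: ideal_module_def)
  ultimately show ?thesis by simp
qed

section \<open>Duality in Artinian Gorenstein rings\<close>

context cring
begin

lemma annihilator_ideal:
  assumes "L \<subseteq> carrier R"
  shows "ideal (annihilator R L) R"
proof (rule idealI_comm)
  show "x \<oplus> y \<in> annihilator R L" if "x \<in> annihilator R L" "y \<in> annihilator R L" for x y
    using that assms by (auto simp: annihilator_def l_distr subset_iff)
  show "r \<otimes> x \<in> annihilator R L" if "r \<in> carrier R" "x \<in> annihilator R L" for r x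
    using that assms by (auto simp: annihilator_def m_assoc subset_iff)
qed (use assms in \<open>auto simp: annihilator_def\<close>)

lemma annihilator_antimono: "K \<subseteq> L \<Longrightarrow> annihilator R L \<subseteq> annihilator R K"
  by (auto simp: annihilator_def)

lemma subset_annihilator_annihilator:
  "L \<subseteq> carrier R \<Longrightarrow> L \<subseteq> annihilator R (annihilator R L)"
  by (auto simp: annihilator_def m_comm subset_iff)

lemma annihilator_carrier: "annihilator R (carrier R) = {\<zero>}"
proof
  show "annihilator R (carrier R) \<subseteq> {\<zero>}"
  proof
    fix x assume "x \<in> annihilator R (carrier R)"
    then have "x \<in> carrier R" "x \<otimes> \<one> = \<zero>" unfolding annihilator_def by blast+
    then show "x \<in> {\<zero>}" by simp
  qed
qed (auto simp: annihilator_def)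

lemma annihilator_set_add:
  assumes "ideal K R" "ideal L R"
  shows "annihilator R (K <+> L) = annihilator R K \<inter> annihilator R L"
proof
  show "annihilator R (K <+> L) \<subseteq> annihilator R K \<inter> annihilator R L"
    using annihilator_antimono set_add_upper1[OF assms] set_add_upper2[OF assms] by blast
  show "annihilator R K \<inter> annihilator R L \<subseteq> annihilator R (K <+> L)"
    using ideal.Icarr[OF assms(1)] ideal.Icarr[OF assms(2)]
    by (auto simp: annihilator_def mem_set_add_iff r_distr)
qed

lemma colon_ideal:
  assumes "ideal X R" "y \<in> carrier R"
  shows "ideal {r \<in> carrier R. r \<otimes> y \<in> X} R"
proof (rule idealI_comm)
  show "p \<oplus> q \<in> {r \<in> carrier R. r \<otimes> y \<in> X}"
    if "p \<in> {r \<in> carrier R. r \<otimes> y \<in> X}" "q \<in> {r \<in> carrier R. r \<otimes> y \<in> X}" for p q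
    using that assms ideal_add_mem by (simp add: l_distr)
  show "p \<otimes> q \<in> {r \<in> carrier R. r \<otimes> y \<in> X}"
    if "p \<in> carrier R" "q \<in> {r \<in> carrier R. r \<otimes> y \<in> X}" for p q
    using that assms ideal.I_l_closed[OF assms(1)] by (simp add: m_assoc)
qed (use assms ideal_zero_mem in auto)

lemma cgenideal_carrier_mem_iff: "x \<in> PIdl y \<longleftrightarrow> (\<exists>r\<in>carrier R. x = r \<otimes> y)"
  by (auto simp: cgenideal_def)

text \<open>Y/X is simple and y generates it, so the annihilator of y modulo X is maximal.
  Concretely, for k outside it X + (k y) is all of Y, so y = x + r k y, and then 1 - r k lies in the
  colon ideal.\<close>

lemma colon_maximal:
  assumes X: "ideal X R" and Y: "ideal Y R" and XY: "X \<subset> Y" and y: "y \<in> Y" "y \<notin> X"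
    and cover: "\<And>K. \<lbrakk>ideal K R; X \<subset> K; K \<subseteq> Y\<rbrakk> \<Longrightarrow> K = Y"
  shows "maximalideal {r \<in> carrier R. r \<otimes> y \<in> X} R"
proof (rule maximalidealI)
  have yc: "y \<in> carrier R" using Y y ideal.Icarr by fast
  let ?N = "{r \<in> carrier R. r \<otimes> y \<in> X}"
  show idN: "ideal ?N R" using X yc by (rule colon_ideal)
  have "\<one> \<notin> ?N" using yc y by simp
  then show "carrier R \<noteq> ?N" by blast
  fix K assume K: "ideal K R" "?N \<subseteq> K" "K \<subseteq> carrier R"
  show "K = ?N \<or> K = carrier R"
  proof (cases "K = ?N")
    case False
    then obtain k where k: "k \<in> K" "k \<notin> ?N" using K by auto
    have kc: "k \<in> carrier R" using k K by auto
    let ?Z = "X <+> PIdl (k \<otimes> y)"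
    have P: "ideal (PIdl (k \<otimes> y)) R" using kc yc by (simp add: cgenideal_ideal)
    have "k \<otimes> y \<in> ?Z" using set_add_upper2[OF X P] cgenideal_self kc yc by auto
    moreover have "k \<otimes> y \<notin> X" using k kc by auto
    ultimately have "X \<subset> ?Z" using set_add_upper1[OF X P] by blast
    moreover have "?Z \<subseteq> Y"
    proof (rule set_add_least[OF Y])
      show "PIdl (k \<otimes> y) \<subseteq> Y" using Y y(1) kc by (simp add: cgenideal_minimal ideal.I_l_closed)
    qed (use XY in auto)
    ultimately have "?Z = Y" using cover[of ?Z] add_ideals[OF X P] by blast
    then obtain x r where xr: "x \<in> X" "r \<in> carrier R" "y = x \<oplus> r \<otimes> (k \<otimes> y)"
      using y(1) by (auto simp: mem_set_add_iff cgenideal_carrier_mem_iff)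
    have xc: "x \<in> carrier R" using xr X ideal.Icarr by fast
    have "(\<one> \<ominus> r \<otimes> k) \<otimes> y = y \<ominus> r \<otimes> (k \<otimes> y)" using xr(2) kc yc by algebra
    also have "\<dots> = (x \<oplus> r \<otimes> (k \<otimes> y)) \<ominus> r \<otimes> (k \<otimes> y)" using xr(3) by simp
    also have "\<dots> = x" using xc xr(2) kc yc by algebra
    finally have "\<one> \<ominus> r \<otimes> k \<in> ?N" using xr(1,2) kc by simp
    moreover have "r \<otimes> k \<in> K" using K(1) k(1) xr(2) by (rule ideal.I_l_closed)
    ultimately have "(\<one> \<ominus> r \<otimes> k) \<oplus> r \<otimes> k \<in> K" using K(1,2) ideal_add_mem by blast
    moreover have "(\<one> \<ominus> r \<otimes> k) \<oplus> r \<otimes> k = \<one>" using xr(2) kc by algebra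
    ultimately show ?thesis using K(1) ideal.one_imp_carrier by metis
  qed simp
qed

end

section \<open>Simplicity of the socle, covers of ideals and biduality\<close>

context artinian_gorenstein_ring
begin

lemma socle_ideal: "ideal (annihilator R M) R"
  by (rule annihilator_ideal) (use Icarr in auto)

text \<open>Otherwise 0, (z) and the socle would form a chain of length 2.\<close>

lemma socle_generated:
  assumes z: "z \<in> annihilator R M" "z \<noteq> \<zero>" and w: "w \<in> annihilator R M"
  shows "w \<in> PIdl z"
proof (rule ccontr)
  assume nw: "w \<notin> PIdl z"
  let ?S = "annihilator R M" and ?N = "\<lambda>i::nat. if i = 0 then {\<zero>} else if i = 1 then PIdl z else annihilator R M"
  have zc: "z \<in> carrier R" using z(1) by (simp add: annihilator_def)
  have sub: "PIdl z \<subseteq> ?S" using socle_ideal z(1) by (rule cgenideal_minimal)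
  have P: "ideal (PIdl z) R" using zc by (rule cgenideal_ideal)
  have "enat 2 \<le> interval_length R {\<zero>} ?S"
    unfolding interval_length_def
  proof (rule chain_length_upper[where N = ?N])
    show "?N i \<in> {K. ideal K R \<and> {\<zero>} \<subseteq> K \<and> K \<subseteq> ?S}" for i
      using P socle_ideal sub zeroideal ideal_zero_mem by auto
    show "?N i \<subset> ?N (Suc i)" if "i < 2" for i
    proof (cases "i = 0")
      case True
      then show ?thesis using ideal_zero_mem[OF P] cgenideal_self[OF zc] z(2) by auto
    next
      case False
      with that have "i = 1" by simp
      then show ?thesis using sub w nw by auto
    qed
  qed
  then show False
    using socle_length module_length_ideal_module[OF socle_ideal] by (simp add: one_enat_def)
qed

text \<open>Multiplication by y in Y outside X maps (0 : X) into the socle, because M y lies in X,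
  and has kernel (0 : Y), because Y = X + (y). As the socle is simple, (0 : X)/(0 : Y) has length at
  most one.\<close>

lemma annihilator_cover:
  assumes X: "ideal X R" and Y: "ideal Y R" and XY: "X \<subset> Y"
    and cover: "\<And>K. \<lbrakk>ideal K R; X \<subset> K; K \<subseteq> Y\<rbrakk> \<Longrightarrow> K = Y"
    and K: "ideal K R" "annihilator R Y \<subset> K" "K \<subseteq> annihilator R X"
  shows "K = annihilator R X"
proof
  obtain y where y: "y \<in> Y" "y \<notin> X" using XY by auto
  have yc: "y \<in> carrier R" using Y y ideal.Icarr by fast
  have N: "{r \<in> carrier R. r \<otimes> y \<in> X} = M"
    using colon_maximal[OF X Y XY y cover] by (rule maximal_unique)
  have P: "ideal (PIdl y) R" using yc by (rule cgenideal_ideal)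
  have XP: "X <+> PIdl y = Y"
  proof (rule cover[OF add_ideals[OF X P]])
    have "y \<in> X <+> PIdl y" using set_add_upper2[OF X P] cgenideal_self[OF yc] by blast
    then show "X \<subset> X <+> PIdl y" using set_add_upper1[OF X P] y by blast
    show "X <+> PIdl y \<subseteq> Y"
      using set_add_least[OF Y] XY cgenideal_minimal[OF Y y(1)] by blast
  qed
  have annY: "z \<in> annihilator R Y" if "z \<in> annihilator R X" "z \<otimes> y = \<zero>" for z
  proof -
    have zc: "z \<in> carrier R" using that(1) by (simp add: annihilator_def)
    have "z \<in> annihilator R (PIdl y)"
      using zc that(2) yc by (auto simp: annihilator_def cgenideal_carrier_mem_iff m_lcomm)
    then show ?thesis using that(1) annihilator_set_add[OF X P] XP by auto
  qed
  have soc: "z \<otimes> y \<in> annihilator R M" if "z \<in> annihilator R X" for z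
    unfolding annihilator_def
  proof (intro CollectI conjI ballI)
    have zc: "z \<in> carrier R" using that by (simp add: annihilator_def)
    then show "z \<otimes> y \<in> carrier R" using yc by simp
    fix m assume "m \<in> M"
    then have m: "m \<in> carrier R" "m \<otimes> y \<in> X" using N by auto
    have "z \<otimes> y \<otimes> m = z \<otimes> (m \<otimes> y)" using zc yc m(1) by algebra
    also have "\<dots> = \<zero>" using that m(2) unfolding annihilator_def by blast
    finally show "z \<otimes> y \<otimes> m = \<zero>" .
  qed
  obtain z where z: "z \<in> K" "z \<notin> annihilator R Y" using K(2) by auto
  then have zX: "z \<in> annihilator R X" using K(3) by auto
  then have zc: "z \<in> carrier R" by (simp add: annihilator_def)
  have zy: "z \<otimes> y \<noteq> \<zero>" using annY zX z(2) by blast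
  show "annihilator R X \<subseteq> K"
  proof
    fix w assume w: "w \<in> annihilator R X"
    then have wc: "w \<in> carrier R" by (simp add: annihilator_def)
    \<comment> \<open>The socle element z y is nonzero and hence generates w y; the difference w - r
      z then kills y and falls into (0 : Y), inside K.\<close>
    obtain r where r: "r \<in> carrier R" "w \<otimes> y = r \<otimes> (z \<otimes> y)"
      using socle_generated[OF soc[OF zX] zy soc[OF w]] by (auto simp: cgenideal_carrier_mem_iff)
    have "(w \<ominus> r \<otimes> z) \<otimes> y = w \<otimes> y \<ominus> r \<otimes> (z \<otimes> y)" using wc zc yc r(1) by algebra
    also have "\<dots> = \<zero>" unfolding r(2) using zc yc r(1) by algebra
    finally have "(w \<ominus> r \<otimes> z) \<otimes> y = \<zero>" .
    moreover have idX: "ideal (annihilator R X) R"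
      using ideal.Icarr[OF X] by (intro annihilator_ideal) auto
    moreover have "w \<ominus> r \<otimes> z \<in> annihilator R X"
      using ideal_minus_mem[OF idX w] ideal.I_l_closed[OF idX zX r(1)] by blast
    ultimately have "w \<ominus> r \<otimes> z \<in> K" using annY K(2) by blast
    moreover have "r \<otimes> z \<in> K" using ideal.I_l_closed[OF K(1) z(1) r(1)] .
    ultimately have "(w \<ominus> r \<otimes> z) \<oplus> r \<otimes> z \<in> K" by (rule ideal_add_mem[OF K(1)])
    moreover have "(w \<ominus> r \<otimes> z) \<oplus> r \<otimes> z = w" using wc zc r(1) by algebra
    ultimately show "w \<in> K" by simp
  qed
qed fact

text \<open>In this form the chain condition gives both induction over ideals and minimal members of
  sets of annihilators.\<close>

lemma wf_ideal_psubset: "wf {(K, L). ideal K R \<and> ideal L R \<and> K \<subset> L}"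
  unfolding wf_iff_no_infinite_down_chain
proof
  assume "\<exists>f. \<forall>i. (f (Suc i), f i) \<in> {(K, L). ideal K R \<and> ideal L R \<and> K \<subset> L}"
  then obtain f where "\<forall>i. ideal (f i) R \<and> f (Suc i) \<subset> f i" by simp blast
  then have f: "\<And>i. ideal (f i) R" "\<And>i. f (Suc i) \<subset> f i" by blast+
  have "\<exists>n. \<forall>m\<ge>n. f m = f n"
    by (rule descending_chain) (use f in \<open>auto simp: less_le\<close>)
  then obtain n where "\<forall>m\<ge>n. f m = f n" by blast
  then have "f (Suc n) = f n" by (meson le_SucI order_refl)
  with f(2) show False by blast
qed

text \<open>Call \<open>L\<close> closed if \<open>(0 : (0 : L)) = L\<close>. A minimal non-closed \<open>L\<close> would have only closed proper
  subideals. On closed ideals annihilation is injective, so the descending chain condition for annihilators yields a maximal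
  proper subideal of \<open>L\<close>, and closedness passes along covers.\<close>

lemma annihilator_annihilator:
  assumes "ideal L R"
  shows "annihilator R (annihilator R L) = L"
  using wf_ideal_psubset assms
proof (induction L)
  case (less L)
  let ?a = "annihilator R"
  have Lc: "K \<subseteq> carrier R" if "ideal K R" for K using that ideal.Icarr by fast
  have closed: "?a (?a K) = K" if "ideal K R" "K \<subset> L" for K
    by (rule less.IH) (use that less.prems in auto)
  show ?case
  proof (cases "L = {\<zero>}")
    case True
    have "?a {\<zero>} = carrier R" by (auto simp: annihilator_def)
    with True show ?thesis by (simp add: annihilator_carrier)
  next
    case False
    let ?Q = "?a ` {K. ideal K R \<and> K \<subset> L}"
    have "{\<zero>} \<subset> L" using False ideal_zero_mem less.prems by auto
    then have "?a {\<zero>} \<in> ?Q" using zeroideal by blast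
    then obtain A where A: "A \<in> ?Q"
      and min: "\<And>B. (B, A) \<in> {(K, L). ideal K R \<and> ideal L R \<and> K \<subset> L} \<Longrightarrow> B \<notin> ?Q"
      using wfE_min[OF wf_ideal_psubset, of _ ?Q] by blast
    obtain X where X: "ideal X R" "X \<subset> L" "A = ?a X" using A by auto
    have cover: "K = L" if K: "ideal K R" "X \<subset> K" "K \<subseteq> L" for K
    proof (rule ccontr)
      assume "K \<noteq> L"
      then have KL: "K \<subset> L" using K by auto
      have "?a K \<noteq> ?a X" using closed[OF K(1) KL] closed[OF X(1,2)] K(2) by (metis less_irrefl)
      then have "?a K \<subset> A" using X(3) annihilator_antimono[of X K] K(2) by auto
      then have "(?a K, A) \<in> {(K, L). ideal K R \<and> ideal L R \<and> K \<subset> L}"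
        using annihilator_ideal[OF Lc[OF K(1)]] annihilator_ideal[OF Lc[OF X(1)]] X(3) by simp
      then show False using min K(1) KL by blast
    qed
    note aX = annihilator_ideal[OF Lc[OF X(1)]] and aL = annihilator_ideal[OF Lc[OF less.prems]]
    show ?thesis
    proof (cases "?a L = ?a X")
      case True
      have "L \<subseteq> ?a (?a L)" by (rule subset_annihilator_annihilator[OF Lc[OF less.prems]])
      also have "\<dots> = X" unfolding True by (rule closed[OF X(1,2)])
      finally show ?thesis using X(2) by blast
    next
      case False
      have sub: "?a L \<subset> ?a X" using False annihilator_antimono[of X L] X(2) by auto
      have "L = ?a (?a L)"
      \<comment> \<open>The cover lemma is applied twice: X below L gives (0 : L) below (0 : X), and
        this pair gives X = (0 : (0 : X)) below (0 : (0 : L)). Since L lies strictly above X in the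
        last interval, it is the top.\<close>
      proof (rule annihilator_cover[OF aL aX sub _ less.prems])
        show "K = ?a X" if "ideal K R" "?a L \<subset> K" "K \<subseteq> ?a X" for K
          by (rule annihilator_cover[OF X(1) less.prems X(2) cover that])
        show "?a (?a X) \<subset> L" unfolding closed[OF X(1,2)] by (rule X(2))
        show "L \<subseteq> ?a (?a L)" by (rule subset_annihilator_annihilator[OF Lc[OF less.prems]])
      qed
      then show ?thesis ..
    qed
  qed
qed

text \<open>By the sum rule and biduality, (0 : K) + (0 : L) has annihilator K \<inter> L;
  annihilating once more recovers the sum.\<close>

lemma annihilator_inter:
  assumes "ideal K R" "ideal L R"
  shows "annihilator R (K \<inter> L) = annihilator R K <+> annihilator R L"
proof -
  have id: "ideal (annihilator R K) R" "ideal (annihilator R L) R"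
    by (rule annihilator_ideal, use assms ideal.Icarr in fast)+
  have "annihilator R (annihilator R K <+> annihilator R L) = K \<inter> L"
    using annihilator_set_add[OF id] annihilator_annihilator assms by simp
  then show ?thesis using annihilator_annihilator[OF add_ideals[OF id]] by simp
qed

text \<open>Biduality makes annihilation injective, so it reverses strict chains. Applying the same
  inequality to the two annihilators gives the converse.\<close>

lemma interval_length_annihilator:
  assumes "ideal X R" "ideal Y R"
  shows "interval_length R (annihilator R Y) (annihilator R X) = interval_length R X Y"
proof -
  have carr: "K \<subseteq> carrier R" if "ideal K R" for K using that ideal.Icarr by fast
  have le: "interval_length R X Y \<le> interval_length R (annihilator R Y) (annihilator R X)"
    if "ideal X R" "ideal Y R" for X Y
    unfolding interval_length_def
  proof (rule chain_length_le_antimono[where f = "annihilator R"])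
    fix K assume K: "K \<in> {K. ideal K R \<and> X \<subseteq> K \<and> K \<subseteq> Y}"
    then show "annihilator R K \<in>
        {K. ideal K R \<and> annihilator R Y \<subseteq> K \<and> K \<subseteq> annihilator R X}"
      using annihilator_ideal[OF carr, of K] annihilator_antimono[of X K] annihilator_antimono[of K Y]
      by simp
    fix L assume L: "L \<in> {K. ideal K R \<and> X \<subseteq> K \<and> K \<subseteq> Y}" and KL: "K \<subset> L"
    have "annihilator R K \<noteq> annihilator R L"
      using K L KL annihilator_annihilator[of K] annihilator_annihilator[of L] by (metis less_irrefl mem_Collect_eq)
    then show "annihilator R L \<subset> annihilator R K" using KL annihilator_antimono[of K L] by auto
  qed
  have "ideal (annihilator R X) R" "ideal (annihilator R Y) R"
    by (rule annihilator_ideal[OF carr[OF assms(1)]], rule annihilator_ideal[OF carr[OF assms(2)]])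
  from le[OF this(2,1)] have
    "interval_length R (annihilator R Y) (annihilator R X) \<le> interval_length R X Y"
    using annihilator_annihilator assms by simp
  with le[OF assms] show ?thesis by (rule antisym[rotated])
qed

text \<open>Annihilation exchanges sums and intersections, which produces the right side of the
  butterfly for the pairs (0 : B), (0 : B') and (0 : A), (0 : A'); reading the butterfly backwards
  restores intersections.\<close>

lemma interval_length_butterfly_dual:
  assumes "ideal A R" "ideal A' R" "ideal B R" "ideal B' R" "A' \<subseteq> A" "B' \<subseteq> B"
  defines "a \<equiv> annihilator R"
  shows "interval_length R ((A \<inter> B') <+> (A' \<inter> B)) (A \<inter> B)
    = interval_length R ((a B' \<inter> a A) <+> (a B \<inter> a A')) (a B' \<inter> a A')"
proof -
  have id: "ideal (a K) R" if "ideal K R" for K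
    unfolding a_def by (rule annihilator_ideal) (use that ideal.Icarr in fast)
  have "interval_length R ((A \<inter> B') <+> (A' \<inter> B)) (A \<inter> B)
      = interval_length R (a (A \<inter> B)) (a ((A \<inter> B') <+> (A' \<inter> B)))"
    unfolding a_def by (intro interval_length_annihilator[symmetric] add_ideals i_intersect assms)
  also have "a (A \<inter> B) = a B <+> a A"
    unfolding a_def using annihilator_inter[OF assms(3,1)] by (simp add: Int_commute)
  also have "a ((A \<inter> B') <+> (A' \<inter> B)) = (a B' <+> a A) \<inter> (a B <+> a A')"
    unfolding a_def using annihilator_set_add[OF i_intersect[OF assms(1,4)] i_intersect[OF assms(2,3)]]
      annihilator_inter[OF assms(4,1)] annihilator_inter[OF assms(3,2)] by (simp add: Int_commute)
  also have "interval_length R (a B <+> a A) ((a B' <+> a A) \<inter> (a B <+> a A'))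
      = interval_length R ((a B' \<inter> a A) <+> (a B \<inter> a A')) (a B' \<inter> a A')"
    unfolding a_def by (intro interval_length_butterfly[symmetric] id[unfolded a_def]
        annihilator_antimono assms(1-6))
  finally show ?thesis unfolding a_def .
qed

end

section \<open>Powers of an ideal and the associated graded ring\<close>

declare Group.nat_pow_Suc [simp del]

context cring
begin

lemma ideal_power_0: "ideal_power R I 0 = carrier R"
  by (simp add: ideals_set_def)

lemma ideal_power_Suc: "ideal_power R I (Suc n) = ideal_power R I n \<cdot> I"
  by (simp add: ideals_set_def Group.nat_pow_Suc)

lemma ideal_power_ideal: "ideal I R \<Longrightarrow> ideal (ideal_power R I n) R"
proof (induction n)
  case 0
  show ?case unfolding ideal_power_0 by (rule oneideal)
next
  case (Suc n)
  then show ?case unfolding ideal_power_Suc by (simp add: ideal_prod_is_ideal)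
qed

lemma ideal_power_antimono:
  assumes "ideal I R" "m \<le> n"
  shows "ideal_power R I n \<subseteq> ideal_power R I m"
proof (rule lift_Suc_antimono_le[OF _ assms(2)])
  show "ideal_power R I (Suc n) \<subseteq> ideal_power R I n" for n
    unfolding ideal_power_Suc using ideal_prod_inter[OF ideal_power_ideal[OF assms(1)] assms(1)] by blast
qed

lemma ideal_power_add:
  assumes "ideal I R"
  shows "ideal_power R I (m + n) = ideal_power R I m \<cdot> ideal_power R I n"
proof (induction n)
  case 0
  then show ?case
    using ideal_prod_one[OF ideal_power_ideal[OF assms]] by (simp only: ideal_power_0 add_0_right)
next
  case (Suc n)
  have "ideal_power R I (m + Suc n) = (ideal_power R I m \<cdot> ideal_power R I n) \<cdot> I"
    unfolding add_Suc_right ideal_power_Suc Suc ..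
  also have "\<dots> = ideal_power R I m \<cdot> (ideal_power R I n \<cdot> I)"
    by (intro ideal_prod_assoc ideal_power_ideal assms)
  finally show ?case unfolding ideal_power_Suc .
qed

lemma rcos_eq_iff:
  assumes "ideal T R" "x \<in> carrier R" "y \<in> carrier R"
  shows "T +> x = T +> y \<longleftrightarrow> x \<ominus> y \<in> T"
  using quotient_eq_iff_same_a_r_cos[OF assms] by simp

lemma mem_rcos_iff: "z \<in> T +> x \<longleftrightarrow> (\<exists>t\<in>T. z = t \<oplus> x)"
  by (auto simp: a_r_coset_def')

lemma rcos_eq_image: "T +> x = (\<lambda>t. t \<oplus> x) ` T"
  by (auto simp: a_r_coset_def')

text \<open>\<open>rcoset_mult\<close> is a union over all representatives; it collapses to one
  coset since (p + r)(t + x) - r x = (p + r) t + x p, where t is in I^(i+1) and x p is in I^i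
  I.\<close>

lemma rcoset_mult_ideal_power:
  assumes I: "ideal I R" and r: "r \<in> carrier R" and x: "x \<in> ideal_power R I i"
  defines "T \<equiv> ideal_power R I (i + 1)"
  shows "rcoset_mult R T (I +> r) (T +> x) = T +> (r \<otimes> x)"
proof -
  have T: "ideal T R" unfolding T_def by (rule ideal_power_ideal[OF I])
  have xc: "x \<in> carrier R" using ideal.Icarr[OF ideal_power_ideal[OF I] x] .
  have eq: "T +> (a \<otimes> b) = T +> (r \<otimes> x)" if ab: "a \<in> I +> r" "b \<in> T +> x" for a b
  proof -
    obtain p t where p: "p \<in> I" "a = p \<oplus> r" and t: "t \<in> T" "b = t \<oplus> x"
      using ab by (auto simp: mem_rcos_iff)
    have c: "p \<in> carrier R" "t \<in> carrier R"
      using ideal.Icarr[OF I p(1)] ideal.Icarr[OF T t(1)] .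
    have "x \<otimes> p \<in> T" unfolding T_def using x p(1) by (simp add: ideal_power_Suc ideal_prod.prod)
    then have "(p \<oplus> r) \<otimes> t \<oplus> x \<otimes> p \<in> T"
      using ideal.I_l_closed[OF T t(1), of "p \<oplus> r"] c r by (simp add: ideal_add_mem[OF T])
    moreover have "a \<otimes> b \<ominus> r \<otimes> x = (p \<oplus> r) \<otimes> t \<oplus> x \<otimes> p"
      unfolding p(2) t(2) using c r xc by algebra
    ultimately show ?thesis
      using rcos_eq_iff[OF T] p(2) t(2) c r xc by simp
  qed
  have "\<zero> \<oplus> r \<in> I +> r" "\<zero> \<oplus> x \<in> T +> x"
    using ideal_zero_mem[OF I] ideal_zero_mem[OF T] by (auto simp: mem_rcos_iff)
  then show ?thesis unfolding rcoset_mult_def using eq by blast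
qed

lemma carrier_FactRing_eq_image: "carrier (R Quot I) = (+>) I ` carrier R"
  by (auto simp: FactRing_def A_RCOSETS_def')

lemma module_length_assoc_graded:
  assumes I: "ideal I R"
  shows "module_length (R Quot I) (assoc_graded R I i)
    = interval_length R (ideal_power R I (i + 1)) (ideal_power R I i)"
proof -
  let ?T = "ideal_power R I (i + 1)" and ?Y = "ideal_power R I i"
  have T: "ideal ?T R" and Y: "ideal ?Y R" by (rule ideal_power_ideal[OF I])+
  have "module_length (R Quot I) (assoc_graded R I i)
      = interval_length R {x \<in> ?Y. ?T +> x = \<zero>\<^bsub>assoc_graded R I i\<^esub>} ?Y"
  proof (rule module_length_image[OF Y, where \<rho> = "(+>) I"])
    show "?T +> (x \<oplus> y) = (?T +> x) \<oplus>\<^bsub>assoc_graded R I i\<^esub> (?T +> y)" if "x \<in> ?Y" "y \<in> ?Y" for x y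
      using ideal.a_rcos_sum[OF T, of x y] that ideal.Icarr[OF Y] by (simp add: assoc_graded_def)
    show "?T +> (r \<otimes> x) = (I +> r) \<odot>\<^bsub>assoc_graded R I i\<^esub> (?T +> x)"
      if "r \<in> carrier R" "x \<in> ?Y" for r x
      using rcoset_mult_ideal_power[OF I that] by (simp add: assoc_graded_def)
    show "?T +> \<zero> = \<zero>\<^bsub>assoc_graded R I i\<^esub>"
      using a_rcos_zero[OF T ideal_zero_mem[OF T]] by (simp add: assoc_graded_def)
  qed (simp_all add: carrier_FactRing_eq_image assoc_graded_def)
  also have "{x \<in> ?Y. ?T +> x = \<zero>\<^bsub>assoc_graded R I i\<^esub>} = ?T"
  proof -
    have "?T +> x = ?T \<longleftrightarrow> x \<in> ?T" if "x \<in> ?Y" for x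
      using ideal.rcos_const_imp_mem[OF T ideal.Icarr[OF Y that]] a_rcos_zero[OF T] by blast
    moreover have "?T \<subseteq> ?Y" by (rule ideal_power_antimono[OF I]) simp
    ultimately show ?thesis by (auto simp: assoc_graded_def)
  qed
  finally show ?thesis .
qed

text \<open>Y maps onto the quotient of its image in I^i/I^(i+1) by the image of Y'. The class of x
  vanishes exactly when x is congruent modulo T to some element of Y', so the kernel is Y \<inter>
  (Y' + T).\<close>

lemma module_length_FactModule_assoc_graded:
  assumes I: "ideal I R" and Y: "ideal Y R" "Y \<subseteq> ideal_power R I i" and Y': "ideal Y' R" "Y' \<subseteq> Y"
  defines "T \<equiv> ideal_power R I (i + 1)"
  shows "module_length (R Quot I)
      (FactModule ((assoc_graded R I i)\<lparr>carrier := (+>) T ` Y\<rparr>) ((+>) T ` Y'))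
    = interval_length R (Y \<inter> (Y' <+> T)) Y"
proof -
  let ?P = "(assoc_graded R I i)\<lparr>carrier := (+>) T ` Y\<rparr>" and ?N = "(+>) T ` Y'"
  \<comment> \<open>A coset modulo \<open>?N\<close> is a set of T-cosets, namely those of the
    elements of \<open>Y' +> x\<close>.\<close>
  let ?\<phi> = "\<lambda>x. (+>) T ` (Y' +> x)"
  have T: "ideal T R" unfolding T_def by (rule ideal_power_ideal[OF I])
  have carr: "K \<subseteq> carrier R" if "ideal K R" for K using ideal.Icarr[OF that] by blast
  note Yc = subsetD[OF carr[OF Y(1)]] and Y'c = subsetD[OF carr[OF Y'(1)]]
  have addP: "(T +> x) \<oplus>\<^bsub>?P\<^esub> (T +> y) = T +> (x \<oplus> y)"
    if "x \<in> carrier R" "y \<in> carrier R" for x y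
    using ideal.a_rcos_sum[OF T that] by (simp add: assoc_graded_def)
  have coset: "?N +>\<^bsub>?P\<^esub> (T +> x) = ?\<phi> x" if "x \<in> carrier R" for x
  proof -
    have "?N +>\<^bsub>?P\<^esub> (T +> x) = (\<lambda>h. (T +> h) \<oplus>\<^bsub>?P\<^esub> (T +> x)) ` Y'"
      by (auto simp: a_r_coset_def')
    also have "\<dots> = (\<lambda>h. T +> (h \<oplus> x)) ` Y'" using addP Y'c that by (intro image_cong) auto
    also have "\<dots> = ?\<phi> x" by (simp add: rcos_eq_image[of Y'] image_image)
    finally show ?thesis .
  qed
  have cosetY': "Y' +> x \<subseteq> carrier R" if "x \<in> carrier R" for x
    using that Y'c by (auto simp: mem_rcos_iff)
  have "module_length (R Quot I) (FactModule ?P ?N)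
      = interval_length R {x \<in> Y. ?\<phi> x = \<zero>\<^bsub>FactModule ?P ?N\<^esub>} Y"
  proof (rule module_length_image[OF Y(1), where \<rho> = "(+>) I"])
    show "(+>) I ` carrier R = carrier (R Quot I)" by (simp add: carrier_FactRing_eq_image)
    have "carrier (FactModule ?P ?N) = (\<lambda>x. ?N +>\<^bsub>?P\<^esub> (T +> x)) ` Y"
      by (auto simp: FactModule_def A_RCOSETS_def')
    also have "\<dots> = ?\<phi> ` Y" by (intro image_cong refl coset Yc)
    finally show "?\<phi> ` Y = carrier (FactModule ?P ?N)" by (rule sym)
    show "?\<phi> (x \<oplus> y) = ?\<phi> x \<oplus>\<^bsub>FactModule ?P ?N\<^esub> ?\<phi> y" if "x \<in> Y" "y \<in> Y" for x y
    proof -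
      have eq: "(T +> s) \<oplus>\<^bsub>?P\<^esub> (T +> t) = T +> (s \<oplus> t)"
        if "s \<in> Y' +> x" "t \<in> Y' +> y" for s t
        using addP that subsetD[OF cosetY'[OF Yc[OF \<open>x \<in> Y\<close>]]] subsetD[OF cosetY'[OF Yc[OF \<open>y \<in> Y\<close>]]]
        by blast
      have "?\<phi> x \<oplus>\<^bsub>FactModule ?P ?N\<^esub> ?\<phi> y
          = (\<Union>s\<in>Y' +> x. \<Union>t\<in>Y' +> y. {(T +> s) \<oplus>\<^bsub>?P\<^esub> (T +> t)})"
        unfolding FactModule_def by (simp add: set_add_def'[of ?P])
      also have "\<dots> = (\<Union>s\<in>Y' +> x. \<Union>t\<in>Y' +> y. {T +> (s \<oplus> t)})"
        by (intro SUP_cong refl) (simp only: eq)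
      also have "\<dots> = (+>) T ` ((Y' +> x) <+> (Y' +> y))"
        unfolding set_add_def' by blast
      also have "\<dots> = ?\<phi> (x \<oplus> y)" using ideal.a_rcos_sum[OF Y'(1) Yc Yc] that by simp
      finally show ?thesis by (rule sym)
    qed
    show "?\<phi> (r \<otimes> x) = (I +> r) \<odot>\<^bsub>FactModule ?P ?N\<^esub> ?\<phi> x" if rx: "r \<in> carrier R" "x \<in> Y" for r x
    proof -
      have xc: "x \<in> carrier R" using Yc rx by blast
      \<comment> \<open>Scalar multiplication in \<open>FactModule\<close> is a union over
        representatives s = y + x; all contribute the same coset, because r s - r x = r y lies in
        Y'.\<close>
      have "?N +>\<^bsub>?P\<^esub> ((I +> r) \<odot>\<^bsub>?P\<^esub> (T +> s)) = ?\<phi> (r \<otimes> x)" if s: "s \<in> Y' +> x" for s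
      proof -
        obtain y where y: "y \<in> Y'" "s = y \<oplus> x" using s by (auto simp: mem_rcos_iff)
        have sY: "s \<in> Y" using y Y'(2) rx(2) ideal_add_mem[OF Y(1)] by auto
        have "(I +> r) \<odot>\<^bsub>?P\<^esub> (T +> s) = T +> (r \<otimes> s)"
          using rcoset_mult_ideal_power[OF I rx(1), of s i] sY Y(2) by (auto simp: assoc_graded_def T_def)
        then have "?N +>\<^bsub>?P\<^esub> ((I +> r) \<odot>\<^bsub>?P\<^esub> (T +> s)) = ?\<phi> (r \<otimes> s)"
          using coset rx(1) Yc[OF sY] by simp
        moreover have "r \<otimes> s \<ominus> r \<otimes> x = r \<otimes> y"
          unfolding y(2) using rx(1) xc Y'c[OF y(1)] by algebra
        then have "Y' +> (r \<otimes> s) = Y' +> (r \<otimes> x)"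
          using rcos_eq_iff[OF Y'(1)] ideal.I_l_closed[OF Y'(1) y(1) rx(1)] rx(1) xc Yc[OF sY] by simp
        ultimately show ?thesis by simp
      qed
      moreover have "\<zero> \<oplus> x \<in> Y' +> x" using ideal_zero_mem[OF Y'(1)] by (auto simp: mem_rcos_iff)
      ultimately have "(\<Union>s\<in>Y' +> x. ?N +>\<^bsub>?P\<^esub> ((I +> r) \<odot>\<^bsub>?P\<^esub> (T +> s))) = ?\<phi> (r \<otimes> x)" by blast
      then show ?thesis by (simp add: FactModule_def)
    qed
    show "?\<phi> \<zero> = \<zero>\<^bsub>FactModule ?P ?N\<^esub>"
      using a_rcos_zero[OF Y'(1) ideal_zero_mem[OF Y'(1)]] by (simp add: FactModule_def)
  qed
  also have "{x \<in> Y. ?\<phi> x = \<zero>\<^bsub>FactModule ?P ?N\<^esub>} = Y \<inter> (Y' <+> T)"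
  proof -
    have iff: "?\<phi> x = ?N \<longleftrightarrow> x \<in> Y' <+> T" if x: "x \<in> Y" for x
    proof
      have xc: "x \<in> carrier R" using Yc[OF x] .
      assume "?\<phi> x = ?N"
      moreover have "\<zero> \<oplus> x \<in> Y' +> x" using ideal_zero_mem[OF Y'(1)] by (auto simp: mem_rcos_iff)
      ultimately have "T +> x \<in> ?N" using xc by (metis image_eqI l_zero)
      then obtain y where y: "y \<in> Y'" "T +> x = T +> y" by auto
      then have "x \<ominus> y \<in> T" using rcos_eq_iff[OF T xc Y'c[OF y(1)]] by simp
      moreover have "x = y \<oplus> (x \<ominus> y)" using xc Y'c[OF y(1)] by algebra
      ultimately show "x \<in> Y' <+> T" using y(1) by (auto simp: mem_set_add_iff)
    next
      assume "x \<in> Y' <+> T"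
      then obtain y t where yt: "y \<in> Y'" "t \<in> T" "x = y \<oplus> t" by (auto simp: mem_set_add_iff)
      have c: "y \<in> carrier R" "t \<in> carrier R" "x \<in> carrier R"
        using Y'c[OF yt(1)] ideal.Icarr[OF T yt(2)] Yc[OF x] .
      have "T +> (h \<oplus> x) = T +> (h \<oplus> y)" if h: "h \<in> Y'" for h
      proof -
        have "h \<oplus> x \<ominus> (h \<oplus> y) = t" unfolding yt(3) using c Y'c[OF h] by algebra
        then show ?thesis using rcos_eq_iff[OF T] yt(2) c Y'c[OF h] by simp
      qed
      then have "(\<lambda>h. T +> (h \<oplus> x)) ` Y' = (\<lambda>h. T +> (h \<oplus> y)) ` Y'" by simp
      moreover have "(\<lambda>h. T +> (h \<oplus> z)) ` Y' = ?\<phi> z" for z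
        by (simp add: rcos_eq_image[of Y'] image_image)
      ultimately have "?\<phi> x = ?\<phi> y" by simp
      also have "\<dots> = ?N" using a_rcos_zero[OF Y'(1) yt(1)] by simp
      finally show "?\<phi> x = ?N" .
    qed
    have "\<zero>\<^bsub>FactModule ?P ?N\<^esub> = ?N" by (simp add: FactModule_def)
    then show ?thesis using iff by (simp cong: conj_cong) blast
  qed
  finally show ?thesis .
qed

end

section \<open>The filtration C(a) and the lengths of its quotients\<close>

locale ideal_in_gorenstein = artinian_gorenstein_ring +
  fixes I and u :: nat
  assumes I: "ideal I R" and u: "end_degree R I u"
begin

abbreviation pow where "pow n \<equiv> ideal_power R I n"
abbreviation ann where "ann L \<equiv> annihilator R L"

lemma pow_ideal: "ideal (pow n) R"
  by (rule ideal_power_ideal[OF I])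

lemma ann_pow_ideal: "ideal (ann (pow n)) R"
  using ideal.Icarr[OF pow_ideal] by (intro annihilator_ideal) blast

text \<open>The ideal upstairs whose image in I^i/I^(i+1) is C(a)_i.\<close>

definition Y_part :: "nat \<Rightarrow> nat \<Rightarrow> 'a set"
  where "Y_part a i = ann (pow (u + 1 - a - i)) \<inter> pow i"

lemma Y_part_ideal: "ideal (Y_part a i) R"
  unfolding Y_part_def by (intro i_intersect ann_pow_ideal pow_ideal)

lemma Y_part_Suc_subset: "Y_part (Suc a) i \<subseteq> Y_part a i"
proof -
  have "u + 1 - Suc a - i \<le> u + 1 - a - i" by simp
  then show ?thesis
    unfolding Y_part_def using annihilator_antimono[OF ideal_power_antimono[OF I]] by blast
qed

lemma Y_part_zero: "Y_part 0 i = pow i"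
proof -
  have "pow i \<subseteq> ann (pow (u + 1 - i))"
  proof
    fix x assume x: "x \<in> pow i"
    have "x \<otimes> y = \<zero>" if y: "y \<in> pow (u + 1 - i)" for y
    proof -
      have "x \<otimes> y \<in> pow (i + (u + 1 - i))"
        unfolding ideal_power_add[OF I] using x y by (rule ideal_prod.prod)
      \<comment> \<open>With truncated subtraction i + (u + 1 - i) can exceed u + 1, hence an
        inclusion and not an equality.\<close>
      also have "\<dots> \<subseteq> pow (u + 1)" by (rule ideal_power_antimono[OF I]) simp
      also have "\<dots> = {\<zero>}" using u by (simp add: end_degree_def)
      finally show ?thesis by simp
    qed
    then show "x \<in> ann (pow (u + 1 - i))"
      using ideal.Icarr[OF pow_ideal x] by (simp add: annihilator_def)
  qed
  then show ?thesis unfolding Y_part_def by auto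
qed

text \<open>The exponent truncates to 0, so what is annihilated is the whole ring. Hence Q(a)
  vanishes above degree u - a, and the filtration ends at a = u + 1.\<close>

lemma Y_part_eq_zero: "u < a + i \<Longrightarrow> Y_part a i = {\<zero>}"
proof -
  assume "u < a + i"
  then have "u + 1 - a - i = 0" by simp
  then show ?thesis
    unfolding Y_part_def using ideal_power_0 annihilator_carrier ideal_zero_mem[OF pow_ideal] by auto
qed

lemma module_length_Q_graded:
  "module_length (R Quot I) (Q_graded R I u a i)
    = interval_length R (Y_part a i \<inter> (Y_part (Suc a) i <+> pow (i + 1))) (Y_part a i)"
proof -
  have "Q_graded R I u a i = FactModule
      ((assoc_graded R I i)\<lparr>carrier := (+>) (pow (i + 1)) ` Y_part a i\<rparr>)
      ((+>) (pow (i + 1)) ` Y_part (Suc a) i)"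
    unfolding Q_graded_def C_graded_def C_part_def Y_part_def by simp
  moreover have "Y_part a i \<subseteq> pow i" by (auto simp: Y_part_def)
  ultimately show ?thesis
    using module_length_FactModule_assoc_graded[OF I Y_part_ideal _ Y_part_ideal Y_part_Suc_subset]
    by simp
qed

lemma module_length_Q_graded_eq_zero:
  assumes "u < a + i"
  shows "module_length (R Quot I) (Q_graded R I u a i) = 0"
proof -
  have "Y_part a i \<inter> (Y_part (Suc a) i <+> pow (i + 1)) = {\<zero>}"
    using Y_part_eq_zero[OF assms] ideal_zero_mem[OF add_ideals[OF Y_part_ideal pow_ideal]] by auto
  then show ?thesis
    unfolding module_length_Q_graded Y_part_eq_zero[OF assms]
    by (simp add: interval_length_refl zeroideal)
qed

lemma module_length_assoc_graded_eq_sum: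
  "module_length (R Quot I) (assoc_graded R I i)
    = (\<Sum>a = 0..u. module_length (R Quot I) (Q_graded R I u a i))"
proof -
  let ?T = "pow (i + 1)"
  \<comment> \<open>The preimage of C(a)_i in I^i. These ideals descend from I^i at a = 0 to I^(i+1)
    at a = u + 1, and the diamond identifies each step with Q(a)_i.\<close>
  define Z where "Z a = Y_part a i <+> ?T" for a
  have Z: "ideal (Z a) R" for a unfolding Z_def by (intro add_ideals Y_part_ideal pow_ideal)
  have sub: "Z (Suc a) \<subseteq> Z a" for a
    unfolding Z_def by (intro set_add_mono Y_part_Suc_subset order_refl)
  have step: "interval_length R (Z (Suc a)) (Z a)
      = module_length (R Quot I) (Q_graded R I u a i)" for a
  proof -
    have "Y_part a i <+> Z (Suc a) = Z a"
    proof
      show "Y_part a i <+> Z (Suc a) \<subseteq> Z a"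
      proof (rule set_add_least[OF Z _ sub])
        show "Y_part a i \<subseteq> Z a" unfolding Z_def by (rule set_add_upper1[OF Y_part_ideal pow_ideal])
      qed
      show "Z a \<subseteq> Y_part a i <+> Z (Suc a)"
        unfolding Z_def by (intro set_add_mono order_refl set_add_upper2 Y_part_ideal pow_ideal)
    qed
    then have "interval_length R (Z (Suc a)) (Z a)
        = interval_length R (Y_part a i \<inter> Z (Suc a)) (Y_part a i)"
      using interval_length_diamond[OF Y_part_ideal Z] by simp
    then show ?thesis by (simp add: module_length_Q_graded Z_def)
  qed
  have sum: "interval_length R (Z n) (Z 0) = (\<Sum>a<n. interval_length R (Z (Suc a)) (Z a))" for n
  proof (induction n)
    case 0
    then show ?case by (simp add: interval_length_refl Z)
  next
    case (Suc n)
    have "interval_length R (Z (Suc n)) (Z 0)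
        = interval_length R (Z (Suc n)) (Z n) + interval_length R (Z n) (Z 0)"
      by (rule interval_length_split[OF Z Z Z sub]) (rule lift_Suc_antimono_le[of Z, OF sub], simp)
    with Suc show ?case by (simp add: add.commute)
  qed
  have T: "?T \<subseteq> pow i" by (rule ideal_power_antimono[OF I]) simp
  have "Z 0 = pow i"
    unfolding Z_def Y_part_zero
    using set_add_least[OF pow_ideal order_refl T] set_add_upper1[OF pow_ideal pow_ideal] by blast
  moreover have "Z (Suc u) = ?T"
    unfolding Z_def Y_part_eq_zero[of "Suc u" i, simplified]
    using set_add_least[OF pow_ideal _ order_refl] set_add_upper2[OF zeroideal pow_ideal]
      ideal_zero_mem[OF pow_ideal] by blast
  ultimately show ?thesis
    using sum[of "Suc u"] by (simp add: module_length_assoc_graded[OF I] step atLeast0AtMost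
        lessThan_Suc_atMost del: sum.lessThan_Suc)
qed

lemma module_length_Q_graded_eq_interval:
  assumes "a + i + j = u"
  shows "module_length (R Quot I) (Q_graded R I u a i)
    = interval_length R ((pow i \<inter> ann (pow j)) <+> (pow (i + 1) \<inter> ann (pow (j + 1))))
        (pow i \<inter> ann (pow (j + 1)))"
proof -
  have "u + 1 - a - i = j + 1" "u + 1 - Suc a - i = j" using assms by auto
  then have Y: "Y_part a i = pow i \<inter> ann (pow (j + 1))" "Y_part (Suc a) i = pow i \<inter> ann (pow j)"
    unfolding Y_part_def by auto
  \<comment> \<open>The modular law moves the intersection inside the sum, which gives the lower end
    a shape symmetric under exchanging i and j with annihilators.\<close>
  have "Y_part a i \<inter> (Y_part (Suc a) i <+> pow (i + 1))
      = Y_part (Suc a) i <+> (Y_part a i \<inter> pow (i + 1))"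
    by (intro ideal_modular_law Y_part_ideal pow_ideal Y_part_Suc_subset)
  also have "Y_part a i \<inter> pow (i + 1) = pow (i + 1) \<inter> ann (pow (j + 1))"
    unfolding Y using ideal_power_antimono[OF I, of i "i + 1"] by auto
  finally show ?thesis unfolding module_length_Q_graded Y by simp
qed

lemma module_length_Q_graded_symmetric:
  assumes "a + i + j = u"
  shows "module_length (R Quot I) (Q_graded R I u a i) = module_length (R Quot I) (Q_graded R I u a j)"
proof -
  have "ann (ann (pow n)) = pow n" for n by (rule annihilator_annihilator[OF pow_ideal])
  then show ?thesis
    \<comment> \<open>Taken with A = I^i, A' = I^(i+1), B = (0 : I^(j+1)), B' = (0 : I^j); biduality
      turns the annihilators of B and B' back into powers of I.\<close>
    using interval_length_butterfly_dual[OF pow_ideal pow_ideal ann_pow_ideal ann_pow_ideal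
        ideal_power_antimono[OF I, of i "i + 1"] annihilator_antimono[OF ideal_power_antimono[OF I, of j "j + 1"]]]
      module_length_Q_graded_eq_interval[OF assms] module_length_Q_graded_eq_interval[of a j i] assms
    by simp
qed

end

theorem theorem1:
  fixes k :: "'k ring" and R :: "('k, 'r) module"
    and M J :: "'r set" and A :: "'r set ring" and I :: "'r set set" and u :: nat
    and H :: "nat \<Rightarrow> int \<Rightarrow> enat"
  assumes "field k"
    and "algebra k R"
    and "local_ring M R"
    and "(\<lambda>c. M +>\<^bsub>R\<^esub> (c \<odot>\<^bsub>R\<^esub> \<one>\<^bsub>R\<^esub>)) \<in> ring_iso k (R Quot M)"
    and "ideal J R"
    and A_def: "A = R Quot J"
    and "artinian_gorenstein_ring ((\<lambda>x. J +>\<^bsub>R\<^esub> x) ` M) A"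
    and "ideal I A"
    and "end_degree A I u"
    and H_def: "\<And>a. H a = hilbert_function (A Quot I) (Q_graded A I u a)"
  shows "(\<forall>i::int. hilbert_function (A Quot I) (assoc_graded A I) i = (\<Sum>a=0..u. H a i))
    \<and> (\<forall>a\<le>u. \<forall>v::int. H a v = H a (int u - int a - v))"
proof -
  have "ideal_in_gorenstein ((\<lambda>x. J +>\<^bsub>R\<^esub> x) ` M) A I u"
    using assms(7-9) by (intro ideal_in_gorenstein.intro ideal_in_gorenstein_axioms.intro)
  note sum = ideal_in_gorenstein.module_length_assoc_graded_eq_sum[OF this]
    and zero = ideal_in_gorenstein.module_length_Q_graded_eq_zero[OF this]
    and symmetric = ideal_in_gorenstein.module_length_Q_graded_symmetric[OF this]
  have "hilbert_function (A Quot I) (assoc_graded A I) i = (\<Sum>a=0..u. H a i)" for i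
    by (simp add: H_def hilbert_function_def sum)
  moreover have "H a v = H a (int u - int a - v)" if a: "a \<le> u" for a v
  proof -
    let ?w = "int u - int a - v"
    \<comment> \<open>If one of the two degrees is negative, where the Hilbert function is 0 by
      convention, the other exceeds u - a, where Q(a) vanishes. Duality is used only when both are
      nonnegative.\<close>
    consider "v < 0" | "?w < 0" "0 \<le> v" | "0 \<le> v" "0 \<le> ?w" by linarith
    then show ?thesis
    proof cases
      case 1
      then have "u < a + nat ?w" using a by linarith
      with 1 show ?thesis by (simp add: H_def hilbert_function_def zero)
    next
      case 2
      then have "u < a + nat v" by linarith
      with 2 show ?thesis by (simp add: H_def hilbert_function_def zero)
    next
      case 3
      then have "a + nat v + nat ?w = u" by linarith
      with 3 show ?thesis
        using symmetric by (simp add: H_def hilbert_function_def)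
    qed
  qed
  ultimately show ?thesis by blast
qed

end
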